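(* Let $n\ge 1$, let $0\le\rho<1$, and let $m:\mathbb{Z}^n\times\mathbb{T}^n\to\mathbb{C}$ be a function such that $m(n',\cdot)$ is smooth on $\mathbb{T}^n$ for every $n'\in\mathbb{Z}^n$. Let $t_m$ be the pseudo-differential operator on $\mathbb{Z}^n$ with symbol $m$, $$t_mf(n')=\int_{\mathbb{T}^n}e^{i2\pi n'\cdot\xi}m(n',\xi)(\mathscr{F}f)(\xi)\,d\xi,\qquad f\in\mathscr{S}(\mathbb{Z}^n),\ n'\in\mathbb{Z}^n.$$ Suppose that for all multi-indices $\alpha,\beta\in\mathbb{N}_0^n$ there is a constant $C_{\alpha,\beta}$ such that $$|\partial_\xi^\beta\Delta_{n'}^\alpha m(n',\xi)|\le C_{\alpha,\beta}(1+|n'|)^{(|\beta|-|\alpha|)\rho}\qquad\text{for all }(n',\xi)\in\mathbb{Z}^n\times\mathbb{T}^n.$$ Then $t_m$ extends to a bounded operator on $\ell^2(\mathbb{Z}^n)$.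
   Context: $\mathbb{T}^n=[0,1]^n$ with opposite faces identified, i.e. $\mathbb{T}^n=\mathbb{R}^n/\mathbb{Z}^n$ (so functions on $\mathbb{T}^n$ are 1-periodic in each variable). $\mathscr{S}(\mathbb{Z}^n)$ is the discrete Schwartz space of rapidly decreasing functions on $\mathbb{Z}^n$. The discrete Fourier transform is $\mathscr{F}f(\xi)=\sum_{n'\in\mathbb{Z}^n}e^{-i2\pi n'\cdot\xi}f(n')$. The partial difference operators act on functions $\sigma$ of the lattice variable by $\Delta_{n'_j}\sigma(n')=\sigma(n'+\delta_j)-\sigma(n')$, where $\delta_j$ is the $j$-th standard unit vector, and $\Delta_{n'}^\alpha=\Delta_{n'_1}^{\alpha_1}\cdots\Delta_{n'_n}^{\alpha_n}$. $\partial_\xi^\beta$ is the usual partial derivative in $\xi\in\mathbb{T}^n$. *)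

theory Defs
  imports "HOL-Analysis.Analysis"
begin

text \<open>
  The dimension \<open>n \<ge> 1\<close> is \<open>CARD('n)\<close> for an index type \<open>'n :: finite\<close>. The lattice is
  \<open>int ^ 'n\<close>, multi-indices are elements of \<open>nat ^ 'n\<close>, and functions on the torus are functions
  on \<open>real ^ 'n\<close> that are 1-periodic in each variable.
\<close>

definition lattice_vec :: "int ^ 'n \<Rightarrow> real ^ 'n" where
  "lattice_vec k = (\<chi> j. real_of_int (k $ j))"

definition mi_order :: "nat ^ ('n::finite) \<Rightarrow> nat" where
  "mi_order \<alpha> = (\<Sum>j\<in>UNIV. \<alpha> $ j)"

text \<open>
  An index type carries no order, so one enumeration \<open>j\<^sub>1, \<dots>, j\<^sub>n\<close> of the coordinates is fixed
  once and for all, and \<open>mi_power D \<alpha>\<close> is \<open>D j\<^sub>1 ^^ (\<alpha> $ j\<^sub>1) \<circ> \<dots> \<circ> D j\<^sub>n ^^ (\<alpha> $ j\<^sub>n)\<close>. The choice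
  is immaterial in both uses below: difference operators commute, and partial derivatives of
  smooth functions commute.
\<close>

definition coords :: "('n::finite) list" where
  "coords = (SOME js. distinct js \<and> set js = UNIV)"

lemma distinct_coords: "distinct (coords :: ('n::finite) list)"
  and set_coords: "set (coords :: 'n list) = UNIV"
proof -
  have "\<exists>js :: 'n list. distinct js \<and> set js = UNIV"
    using finite_distinct_list[of "UNIV :: 'n set"] by auto
  then have "distinct (coords :: 'n list) \<and> set (coords :: 'n list) = UNIV"
    unfolding coords_def by (rule someI_ex)
  then show "distinct (coords :: 'n list)" and "set (coords :: 'n list) = UNIV"
    by auto
qed

definition mi_power :: "('n::finite \<Rightarrow> 'a \<Rightarrow> 'a) \<Rightarrow> nat ^ 'n \<Rightarrow> 'a \<Rightarrow> 'a" where
  "mi_power D \<alpha> = foldr (\<lambda>j. D j ^^ (\<alpha> $ j)) coords"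

definition partial_diff :: "'n::finite \<Rightarrow> (int ^ 'n \<Rightarrow> complex) \<Rightarrow> int ^ 'n \<Rightarrow> complex" where
  "partial_diff j \<sigma> k = \<sigma> (k + axis j 1) - \<sigma> k"

definition partial_deriv :: "'n::finite \<Rightarrow> (real ^ 'n \<Rightarrow> complex) \<Rightarrow> real ^ 'n \<Rightarrow> complex" where
  "partial_deriv j g x = vector_derivative (\<lambda>t. g (x + t *\<^sub>R axis j 1)) (at 0)"

text \<open>
  Smoothness on \<open>real ^ 'n\<close>: the iterated partial derivatives along every list of coordinate
  directions exist and are continuous.
\<close>

definition smooth :: "(real ^ ('n::finite) \<Rightarrow> complex) \<Rightarrow> bool" where
  "smooth g \<longleftrightarrow>
    (\<forall>js. continuous_on UNIV (foldr partial_deriv js g) \<and>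
      (\<forall>j x. (\<lambda>t. foldr partial_deriv js g (x + t *\<^sub>R axis j 1)) differentiable (at 0)))"

definition smooth_torus :: "(real ^ ('n::finite) \<Rightarrow> complex) \<Rightarrow> bool" where
  "smooth_torus g \<longleftrightarrow> (\<forall>j x. g (x + axis j 1) = g x) \<and> smooth g"

definition schwartz_lattice :: "(int ^ ('n::finite) \<Rightarrow> complex) set" where
  "schwartz_lattice = {f. \<forall>N::nat. \<exists>C. \<forall>k. (1 + norm (lattice_vec k)) ^ N * cmod (f k) \<le> C}"

definition discrete_fourier :: "(int ^ ('n::finite) \<Rightarrow> complex) \<Rightarrow> real ^ 'n \<Rightarrow> complex" where
  "discrete_fourier f \<xi> =
    (\<Sum>\<^sub>\<infinity>k. exp (- \<i> * complex_of_real (2 * pi * (lattice_vec k \<bullet> \<xi>))) * f k)"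

definition pseudo_diff_op ::
    "(int ^ ('n::finite) \<Rightarrow> real ^ 'n \<Rightarrow> complex) \<Rightarrow> (int ^ 'n \<Rightarrow> complex) \<Rightarrow> int ^ 'n \<Rightarrow> complex" where
  "pseudo_diff_op m f k =
    (LINT \<xi>:cbox 0 1|lborel.
      exp (\<i> * complex_of_real (2 * pi * (lattice_vec k \<bullet> \<xi>))) * m k \<xi> * discrete_fourier f \<xi>)"

definition l2_lattice :: "(int ^ ('n::finite) \<Rightarrow> complex) set" where
  "l2_lattice = {f. (\<lambda>k. (cmod (f k))\<^sup>2) summable_on UNIV}"

definition l2_norm :: "(int ^ ('n::finite) \<Rightarrow> complex) \<Rightarrow> real" where
  "l2_norm f = sqrt (\<Sum>\<^sub>\<infinity>k. (cmod (f k))\<^sup>2)"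

text \<open>Only the values of \<open>T\<close> on \<open>l2_lattice\<close> matter.\<close>

definition bounded_op_l2 ::
    "((int ^ ('n::finite) \<Rightarrow> complex) \<Rightarrow> int ^ 'n \<Rightarrow> complex) \<Rightarrow> bool" where
  "bounded_op_l2 T \<longleftrightarrow>
    T ` l2_lattice \<subseteq> l2_lattice \<and>
    (\<forall>f\<in>l2_lattice. \<forall>g\<in>l2_lattice. T (\<lambda>k. f k + g k) = (\<lambda>k. T f k + T g k)) \<and>
    (\<forall>c. \<forall>f\<in>l2_lattice. T (\<lambda>k. c * f k) = (\<lambda>k. c * T f k)) \<and>
    (\<exists>C. \<forall>f\<in>l2_lattice. l2_norm (T f) \<le> C * l2_norm f)"

end

theory Submission
  imports Defs
begin

text \<open>
  Let \<open>K k x\<close> be the \<open>x\<close>-th Fourier coefficient of \<open>m k\<close>. Then \<open>t\<^sub>m f k = (\<Sum>l. K k (k - l) * f l)\<close>, and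
  the claim is an \<open>\<ell>\<^sup>2\<close> bound for the finite sections of this matrix.

  The lattice is cut into boxes that are adapted to the symbol: near points with
  \<open>1 + norm k \<approx> 2 ^ s\<close> the boxes have side \<open>L \<approx> 2 powr (s * \<rho>)\<close>, so that on such a box a difference in
  \<open>k\<close> gains a factor \<open>1 / L\<close> and a derivative in \<open>\<xi>\<close> costs a factor \<open>L\<close>. Two observations give the bound
  on one box.

  \<^item> If \<open>m k\<close> did not depend on \<open>k\<close>, the operator would be a Fourier multiplier, bounded by Bessel's
    inequality (\<open>fourier_multiplier_bound\<close>). The dependence on \<open>k\<close> is removed by telescoping from the
    corner of the box, one coordinate after another: each of the \<open>L\<close> steps in a coordinate costs one
    difference, which is worth \<open>1 / L\<close>, so that all steps together cost a constant
    (\<open>discrete_sobolev\<close>). Only differences of order at most one in each coordinate occur.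

  \<^item> Let \<open>P l = 1 + (\<Sum>j. ((l\<^sub>j - c\<^sub>j) / L) ^ (2 * M))\<close> for a box with corner \<open>c\<close>. Expanding \<open>l\<^sub>j - c\<^sub>j\<close> as
    \<open>(l\<^sub>j - k\<^sub>j) + (k\<^sub>j - c\<^sub>j)\<close> with the binomial theorem turns the powers of \<open>l\<^sub>j - k\<^sub>j\<close> into pure
    derivatives of the symbol. Since \<open>k\<close> lies in the box, the operator applied to \<open>P * g\<close> is therefore
    again bounded on the box by the norm of \<open>g\<close> (\<open>box_estimate\<close>). With \<open>g = f / P\<close> this says that the
    box only sees the part of \<open>f\<close> close to it, up to tails of high polynomial order.

  Summing over all boxes leaves the sum of \<open>1 / (P l)\<^sup>2\<close> over the boxes, for fixed \<open>l\<close>, to be bounded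
  (\<open>box_weight_sum_bounded\<close>). Boxes of one dyadic level contribute a constant, and levels that are not
  comparable with \<open>1 + norm l\<close> contribute a convergent geometric series, because a distance of order
  \<open>2 ^ s\<close> is large compared with \<open>L\<close>. This is where \<open>\<rho> < 1\<close> enters.
\<close>

section \<open>Integration of periodic functions over the unit cube\<close>

text \<open>
  The shifted cube is cut by the face \<open>x\<^sub>j = 1\<close> of the original one, and the part that sticks out is moved
  back by periodicity.
\<close>

lemma integral_unit_cube_shift:
  fixes h :: "real ^ 'n::finite \<Rightarrow> 'b::euclidean_space"
  assumes cont: "continuous_on UNIV h"
    and per: "\<And>x. h (x + axis j 1) = h x"
    and t: "0 \<le> t" "t \<le> 1"
  shows "integral (cbox 0 1) (\<lambda>x. h (x + t *\<^sub>R axis j 1)) = integral (cbox 0 1) h"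
proof -
  let ?e = "axis j 1 :: real ^ 'n"
  have e: "?e \<in> Basis" by (simp add: axis_in_Basis_iff)
  have int: "h integrable_on cbox a b" for a b
    by (rule integrable_continuous) (use cont continuous_on_subset in blast)
  have in_e: "x \<bullet> ?e = x $ j" for x by (simp add: inner_axis)
  have ax: "?e $ i = (if i = j then 1 else 0)" for i by (simp add: axis_def)
  have box: "x \<in> cbox a b \<longleftrightarrow> (a $ j \<le> x $ j \<and> x $ j \<le> b $ j) \<and>
      (\<forall>i. i \<noteq> j \<longrightarrow> a $ i \<le> x $ i \<and> x $ i \<le> b $ i)" for a b x :: "real ^ 'n"
    unfolding mem_box_cart by auto
  have s1: "cbox (t *\<^sub>R ?e) (1 + t *\<^sub>R ?e) \<inter> {x. x \<bullet> ?e \<le> 1} = cbox (t *\<^sub>R ?e) 1"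
    using t by (intro set_eqI) (auto simp: box in_e ax)
  have s2: "cbox (t *\<^sub>R ?e) (1 + t *\<^sub>R ?e) \<inter> {x. x \<bullet> ?e \<ge> 1} = cbox ?e (1 + t *\<^sub>R ?e)"
    using t by (intro set_eqI) (auto simp: box in_e ax)
  have s3: "cbox 0 1 \<inter> {x. x \<bullet> ?e \<le> t} = cbox (?e - ?e) (1 + t *\<^sub>R ?e - ?e)"
    using t by (intro set_eqI) (auto simp: box in_e ax)
  have s4: "cbox 0 1 \<inter> {x. x \<bullet> ?e \<ge> t} = cbox (t *\<^sub>R ?e) 1"
    using t by (intro set_eqI) (auto simp: box in_e ax)
  have "integral (cbox 0 1) (\<lambda>x. h (x + t *\<^sub>R ?e)) = integral (cbox (t *\<^sub>R ?e) (1 + t *\<^sub>R ?e)) h"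
    using integral_shift_cbox[of "t *\<^sub>R ?e" "t *\<^sub>R ?e" "1 + t *\<^sub>R ?e" h] by simp
  also have "\<dots> = integral (cbox (t *\<^sub>R ?e) 1) h + integral (cbox ?e (1 + t *\<^sub>R ?e)) h"
    using integral_split[OF int e, of "t *\<^sub>R ?e" "1 + t *\<^sub>R ?e" 1] unfolding s1 s2 .
  also have "integral (cbox ?e (1 + t *\<^sub>R ?e)) h = integral (cbox (?e - ?e) (1 + t *\<^sub>R ?e - ?e)) h"
    using integral_shift_cbox[of ?e ?e "1 + t *\<^sub>R ?e" h] per by simp
  also have "integral (cbox (t *\<^sub>R ?e) 1) h + \<dots> = integral (cbox 0 1) h"
    using integral_split[OF int e, of 0 1 t] unfolding s3 s4 by simp
  finally show ?thesis .
qed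

text \<open>
  Differentiate the integral of the shifted function, which is constant in the shift, under the
  integral sign.
\<close>

lemma integral_unit_cube_derivative:
  fixes h h' :: "real ^ 'n::finite \<Rightarrow> complex"
  assumes cont: "continuous_on UNIV h" and cont': "continuous_on UNIV h'"
    and per: "\<And>x. h (x + axis j 1) = h x"
    and deriv: "\<And>x. ((\<lambda>t. h (x + t *\<^sub>R axis j 1)) has_vector_derivative h' x) (at 0)"
  shows "integral (cbox 0 1) h' = 0"
proof -
  let ?e = "axis j 1 :: real ^ 'n"
  let ?\<phi> = "\<lambda>t. integral (cbox 0 1) (\<lambda>x. h (x + t *\<^sub>R ?e))"
  have deriv_t: "((\<lambda>t. h (x + t *\<^sub>R ?e)) has_vector_derivative h' (x + s *\<^sub>R ?e)) (at s within U)"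
    for x s U
  proof -
    have "((\<lambda>t. h ((x + s *\<^sub>R ?e) + t *\<^sub>R ?e)) has_vector_derivative h' (x + s *\<^sub>R ?e)) (at 0)"
      by (rule deriv)
    then have "((\<lambda>t. h ((x + s *\<^sub>R ?e) + t *\<^sub>R ?e)) \<circ> (\<lambda>t. t - s) has_vector_derivative
        1 *\<^sub>R h' (x + s *\<^sub>R ?e)) (at s)"
      by (intro vector_diff_chain_at) (auto intro!: derivative_eq_intros simp: has_vector_derivative_def)
    moreover have "(\<lambda>t. h ((x + s *\<^sub>R ?e) + t *\<^sub>R ?e)) \<circ> (\<lambda>t. t - s) = (\<lambda>t. h (x + t *\<^sub>R ?e))"
      by (auto simp: fun_eq_iff algebra_simps)
    ultimately show ?thesis
      by (auto intro: has_vector_derivative_at_within)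
  qed
  have "(?\<phi> has_vector_derivative integral (cbox 0 1) (\<lambda>x. h' (x + 0 *\<^sub>R ?e))) (at 0 within {0..1})"
  proof (rule leibniz_rule_vector_derivative)
    show "((\<lambda>s. h (x + s *\<^sub>R ?e)) has_vector_derivative h' (x + s *\<^sub>R ?e)) (at s within {0..1})" for x s
      by (rule deriv_t)
    show "(\<lambda>x. h (x + s *\<^sub>R ?e)) integrable_on cbox 0 1" for s
      by (intro integrable_continuous continuous_on_compose2[OF cont] continuous_intros) auto
    show "continuous_on ({0..1} \<times> cbox 0 1) (\<lambda>(s, x). h' (x + s *\<^sub>R ?e))"
      unfolding split_beta by (intro continuous_on_compose2[OF cont'] continuous_intros) auto
  qed auto
  moreover have "((\<lambda>_. integral (cbox 0 1) h) has_vector_derivative 0) (at 0 within {0..1::real})"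
    by (rule has_vector_derivative_const)
  then have "(?\<phi> has_vector_derivative 0) (at 0 within {0..1})"
    by (rule has_vector_derivative_transform[rotated 2])
       (use integral_unit_cube_shift[OF cont per] in auto)
  ultimately show ?thesis
    using vector_derivative_unique_within[of 0 "{0..1::real}"]
    by (metis (no_types, lifting) add.right_neutral scale_zero_left trivial_limit_within
        islimpt_Icc less_numeral_extra(1) atLeastAtMost_iff order_refl zero_le_one ext)
qed

section \<open>Characters and Bessel's inequality\<close>

definition torus_char :: "int ^ 'n::finite \<Rightarrow> real ^ 'n \<Rightarrow> complex" where
  "torus_char k \<xi> = exp (\<i> * complex_of_real (2 * pi * (lattice_vec k \<bullet> \<xi>)))"

lemma lattice_vec_simps [simp]:
  "lattice_vec k $ j = real_of_int (k $ j)"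
  "lattice_vec (k + l) = lattice_vec k + lattice_vec l"
  "lattice_vec (k - l) = lattice_vec k - lattice_vec l"
  "lattice_vec (- k) = - lattice_vec k"
  "lattice_vec 0 = (0 :: real ^ 'n::finite)"
  by (auto simp: lattice_vec_def vec_eq_iff)

lemma
  fixes k l :: "int ^ 'n::finite"
  shows torus_char_add: "torus_char (k + l) \<xi> = torus_char k \<xi> * torus_char l \<xi>"
    and torus_char_uminus: "torus_char (- k) \<xi> = cnj (torus_char k \<xi>)"
    and norm_torus_char: "cmod (torus_char k \<xi>) = 1"
    and torus_char_0: "torus_char 0 \<xi> = 1"
    and continuous_on_torus_char: "continuous_on A (torus_char k)"
    and torus_char_shift: "torus_char k (\<xi> + t *\<^sub>R axis j 1)
      = exp (\<i> * complex_of_real (2 * pi * t * k $ j)) * torus_char k \<xi>"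
  by (auto simp: torus_char_def distrib_left algebra_simps exp_add[symmetric] exp_cnj inner_add_left
      inner_add_right inner_axis norm_exp_eq_Re intro!: continuous_intros)

lemma torus_char_diff: "torus_char (k - l) \<xi> = torus_char k \<xi> * cnj (torus_char l \<xi>)"
  using torus_char_add[of k "-l"] by (simp add: torus_char_uminus)

lemma torus_char_periodic: "torus_char k (\<xi> + axis j 1) = torus_char k \<xi>"
  using torus_char_shift[of k \<xi> 1 j] exp_integer_2pi[of "of_int (k $ j)"]
  by (simp add: mult_ac)

text \<open>
  A shift by half a period in a coordinate with \<open>k $ j \<noteq> 0\<close> changes the sign of the character.
\<close>

lemma integral_torus_char:
  "integral (cbox 0 1) (torus_char k) = (if k = 0 then 1 else 0)"
proof (cases "k = 0")
  case True
  have "torus_char k = (\<lambda>\<xi>. 1)" using True by (simp add: torus_char_0 fun_eq_iff)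
  moreover have "measure lborel (cbox 0 (1 :: real ^ 'a)) = 1"
    by (simp add: content_cbox_cart interval_ne_empty_cart)
  ultimately show ?thesis using True by simp
next
  case False
  then obtain j where j: "k $ j \<noteq> 0" by (auto simp: vec_eq_iff)
  define t :: real where "t = 1 / (2 * \<bar>k $ j\<bar>)"
  have t: "0 \<le> t" "t \<le> 1" using j by (auto simp: t_def field_simps)
  have "exp (\<i> * complex_of_real (2 * pi * t * k $ j)) = -1"
  proof (cases "k $ j > 0")
    case True
    then have "2 * pi * t * k $ j = pi" by (simp add: t_def)
    then show ?thesis by (simp only: exp_pi_i')
  next
    case False
    then have "2 * pi * t * k $ j = - pi" using j by (simp add: t_def)
    then show ?thesis by (simp only: of_real_minus mult_minus_right exp_minus exp_pi_i') simp
  qed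
  then have "torus_char k (\<xi> + t *\<^sub>R axis j 1) = - torus_char k \<xi>" for \<xi>
    by (simp add: torus_char_shift)
  then have "integral (cbox 0 1) (torus_char k) = - integral (cbox 0 1) (torus_char k)"
    using integral_unit_cube_shift[of "torus_char k" j t, OF continuous_on_torus_char torus_char_periodic t]
    by simp
  then show ?thesis using False by simp
qed

text \<open>
  The sign of the exponent makes \<open>fourier_coeff (m k) (k - l)\<close> the matrix entry at \<open>(k, l)\<close> of the
  pseudo-differential operator. Correspondingly, \<open>trig_poly g F\<close> is the discrete Fourier transform of
  the restriction of \<open>g\<close> to \<open>F\<close>.
\<close>

definition fourier_coeff :: "(real ^ 'n::finite \<Rightarrow> complex) \<Rightarrow> int ^ 'n \<Rightarrow> complex" where
  "fourier_coeff g k = integral (cbox 0 1) (\<lambda>\<xi>. torus_char k \<xi> * g \<xi>)"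

definition trig_poly :: "(int ^ 'n::finite \<Rightarrow> complex) \<Rightarrow> (int ^ 'n) set \<Rightarrow> real ^ 'n \<Rightarrow> complex" where
  "trig_poly g F \<xi> = (\<Sum>l\<in>F. g l * cnj (torus_char l \<xi>))"

lemma continuous_on_trig_poly: "continuous_on A (trig_poly g F)"
  unfolding trig_poly_def by (intro continuous_intros continuous_on_torus_char)

lemma fourier_coeff_times_trig_poly:
  fixes a :: "real ^ 'n::finite \<Rightarrow> complex"
  assumes "continuous_on UNIV a"
  shows "fourier_coeff (\<lambda>\<xi>. a \<xi> * trig_poly g F \<xi>) k = (\<Sum>l\<in>F. fourier_coeff a (k - l) * g l)"
proof -
  have "fourier_coeff (\<lambda>\<xi>. a \<xi> * trig_poly g F \<xi>) k
      = integral (cbox 0 1) (\<lambda>\<xi>. \<Sum>l\<in>F. torus_char (k - l) \<xi> * a \<xi> * g l)"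
    unfolding fourier_coeff_def
    by (intro integral_cong) (simp add: trig_poly_def sum_distrib_left torus_char_diff mult_ac)
  also have "\<dots> = (\<Sum>l\<in>F. integral (cbox 0 1) (\<lambda>\<xi>. torus_char (k - l) \<xi> * a \<xi> * g l))"
    by (cases "finite F", subst integral_sum)
       (auto simp del: integral_mult_left intro!: integrable_continuous continuous_intros
          continuous_on_torus_char intro: continuous_on_subset[OF assms])
  also have "\<dots> = (\<Sum>l\<in>F. fourier_coeff a (k - l) * g l)"
    unfolding fourier_coeff_def by (intro sum.cong integral_mult_left refl)
  finally show ?thesis .
qed

lemma integral_norm_trig_poly:
  assumes "finite F"
  shows "integral (cbox 0 1) (\<lambda>\<xi>. (cmod (trig_poly g F \<xi>))\<^sup>2) = (\<Sum>l\<in>F. (cmod (g l))\<^sup>2)"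
proof -
  have sq: "complex_of_real ((cmod (trig_poly g F \<xi>))\<^sup>2)
      = (\<Sum>l\<in>F. \<Sum>l'\<in>F. g l * cnj (g l') * torus_char (l' - l) \<xi>)" for \<xi>
    unfolding complex_norm_square trig_poly_def
    by (simp add: sum_product torus_char_diff mult_ac)
  have "complex_of_real (integral (cbox 0 1) (\<lambda>\<xi>. (cmod (trig_poly g F \<xi>))\<^sup>2))
      = integral (cbox 0 1) (\<lambda>\<xi>. complex_of_real ((cmod (trig_poly g F \<xi>))\<^sup>2))"
    by (rule integral_linear[OF _ bounded_linear_of_real, unfolded o_def, symmetric])
       (intro integrable_continuous continuous_intros continuous_on_trig_poly)
  also have "\<dots> = (\<Sum>l\<in>F. \<Sum>l'\<in>F. integral (cbox 0 1) (\<lambda>\<xi>. g l * cnj (g l') * torus_char (l' - l) \<xi>))"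
    unfolding sq
    by (subst integral_sum, fact assms)
       (auto simp del: integral_mult_right intro!: sum.cong integral_sum assms integrable_sum integrable_continuous
         continuous_intros continuous_on_torus_char)
  also have "\<dots> = (\<Sum>l\<in>F. \<Sum>l'\<in>F. if l' = l then g l * cnj (g l') else 0)"
    by (intro sum.cong refl) (simp add: integral_torus_char)
  also have "\<dots> = complex_of_real (\<Sum>l\<in>F. (cmod (g l))\<^sup>2)"
    using assms by (simp add: complex_norm_square del: of_real_power)
  finally show ?thesis by (simp only: of_real_eq_iff)
qed

text \<open>
  The difference of both sides is the integral of \<open>(cmod (h - p))\<^sup>2\<close>, where \<open>p\<close> is the orthogonal
  projection of \<open>h\<close> to the characters indexed by \<open>X\<close>.
\<close>

lemma bessel_torus:
  assumes cont: "continuous_on UNIV h" and fin: "finite X"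
  shows "(\<Sum>k\<in>X. (cmod (fourier_coeff h k))\<^sup>2) \<le> integral (cbox 0 1) (\<lambda>\<xi>. (cmod (h \<xi>))\<^sup>2)"
proof -
  let ?p = "trig_poly (fourier_coeff h) X"
  note cont_h = continuous_on_subset[OF cont subset_UNIV]
  have int: "f integrable_on cbox 0 1" if "continuous_on UNIV f" for f :: "real ^ 'a \<Rightarrow> 'c::banach"
    by (rule integrable_continuous) (rule continuous_on_subset[OF that subset_UNIV])
  have cross: "integral (cbox 0 1) (\<lambda>\<xi>. h \<xi> * cnj (?p \<xi>)) = (\<Sum>k\<in>X. (cmod (fourier_coeff h k))\<^sup>2)"
  proof -
    have "integral (cbox 0 1) (\<lambda>\<xi>. h \<xi> * cnj (?p \<xi>))
        = integral (cbox 0 1) (\<lambda>\<xi>. \<Sum>k\<in>X. cnj (fourier_coeff h k) * (torus_char k \<xi> * h \<xi>))"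
      by (intro integral_cong) (simp add: trig_poly_def sum_distrib_left mult_ac)
    also have "\<dots> = (\<Sum>k\<in>X. cnj (fourier_coeff h k) * fourier_coeff h k)"
      by (subst integral_sum)
         (auto intro!: fin int continuous_intros continuous_on_torus_char cont_h simp: fourier_coeff_def)
    also have "\<dots> = (\<Sum>k\<in>X. (cmod (fourier_coeff h k))\<^sup>2)"
      by (simp add: complex_norm_square mult.commute del: of_real_power)
    finally show ?thesis by simp
  qed
  have "(cmod (h \<xi> - ?p \<xi>))\<^sup>2 = (cmod (h \<xi>))\<^sup>2 - 2 * Re (h \<xi> * cnj (?p \<xi>)) + (cmod (?p \<xi>))\<^sup>2" for \<xi>
    unfolding cmod_power2 by (simp add: power2_eq_square algebra_simps)
  then have "integral (cbox 0 1) (\<lambda>\<xi>. (cmod (h \<xi> - ?p \<xi>))\<^sup>2)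
      = integral (cbox 0 1) (\<lambda>\<xi>. (cmod (h \<xi>))\<^sup>2 - 2 * Re (h \<xi> * cnj (?p \<xi>)) + (cmod (?p \<xi>))\<^sup>2)"
    by simp
  also have "\<dots> = integral (cbox 0 1) (\<lambda>\<xi>. (cmod (h \<xi>))\<^sup>2)
      - 2 * integral (cbox 0 1) (\<lambda>\<xi>. Re (h \<xi> * cnj (?p \<xi>))) + integral (cbox 0 1) (\<lambda>\<xi>. (cmod (?p \<xi>))\<^sup>2)"
    by (subst integral_add integral_diff integral_mult_right;
        (intro int continuous_intros continuous_on_trig_poly cont_h)?)+ simp
  also have "integral (cbox 0 1) (\<lambda>\<xi>. Re (h \<xi> * cnj (?p \<xi>)))
      = Re (integral (cbox 0 1) (\<lambda>\<xi>. h \<xi> * cnj (?p \<xi>)))"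
    by (rule integral_linear[OF _ bounded_linear_Re, unfolded o_def])
       (intro int continuous_intros continuous_on_trig_poly cont_h)
  finally have "integral (cbox 0 1) (\<lambda>\<xi>. (cmod (h \<xi> - ?p \<xi>))\<^sup>2)
      = integral (cbox 0 1) (\<lambda>\<xi>. (cmod (h \<xi>))\<^sup>2) - (\<Sum>k\<in>X. (cmod (fourier_coeff h k))\<^sup>2)"
    by (simp add: cross integral_norm_trig_poly[OF fin])
  moreover have "0 \<le> integral (cbox 0 1) (\<lambda>\<xi>. (cmod (h \<xi> - ?p \<xi>))\<^sup>2)"
    by (intro integral_nonneg int continuous_intros continuous_on_trig_poly cont_h) auto
  ultimately show ?thesis by simp
qed

lemma fourier_multiplier_bound:
  assumes cont: "continuous_on UNIV a" and bound: "\<And>\<xi>. cmod (a \<xi>) \<le> A"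
    and fin: "finite X" "finite F"
  shows "L2_set (\<lambda>k. cmod (fourier_coeff (\<lambda>\<xi>. a \<xi> * trig_poly g F \<xi>) k)) X
    \<le> A * L2_set (\<lambda>l. cmod (g l)) F"
proof -
  note cont_a = continuous_on_subset[OF cont subset_UNIV]
  have A: "0 \<le> A" using norm_ge_zero order_trans bound by blast
  have "(\<Sum>k\<in>X. (cmod (fourier_coeff (\<lambda>\<xi>. a \<xi> * trig_poly g F \<xi>) k))\<^sup>2)
      \<le> integral (cbox 0 1) (\<lambda>\<xi>. (cmod (a \<xi> * trig_poly g F \<xi>))\<^sup>2)"
    by (intro bessel_torus fin continuous_intros continuous_on_trig_poly cont_a)
  also have "\<dots> \<le> integral (cbox 0 1) (\<lambda>\<xi>. A\<^sup>2 * (cmod (trig_poly g F \<xi>))\<^sup>2)"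
  proof (rule integral_le)
    show "(cmod (a \<xi> * trig_poly g F \<xi>))\<^sup>2 \<le> A\<^sup>2 * (cmod (trig_poly g F \<xi>))\<^sup>2" for \<xi>
      unfolding norm_mult power_mult_distrib by (intro mult_right_mono power_mono bound) auto
  qed (intro integrable_continuous continuous_intros continuous_on_trig_poly cont_a)+
  also have "\<dots> = A\<^sup>2 * (\<Sum>l\<in>F. (cmod (g l))\<^sup>2)"
    by (simp add: integral_norm_trig_poly[OF fin(2)])
  also have "\<dots> = (A * L2_set (\<lambda>l. cmod (g l)) F)\<^sup>2"
    unfolding L2_set_def power_mult_distrib by (simp add: sum_nonneg)
  finally show ?thesis
    unfolding L2_set_def[of _ X] using A by (intro real_le_lsqrt) (auto intro!: sum_nonneg)
qed

section \<open>Fourier coefficients of derivatives\<close>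

lemma partial_deriv_has_vector_derivative:
  assumes "smooth g"
  shows "((\<lambda>t. foldr partial_deriv js g (x + t *\<^sub>R axis j 1)) has_vector_derivative
    foldr partial_deriv (j # js) g x) (at 0)"
  using assms unfolding smooth_def by (simp add: partial_deriv_def vector_derivative_works[symmetric])

lemma smooth_foldr:
  assumes "smooth g" shows "smooth (foldr partial_deriv js g)"
  using assms unfolding smooth_def foldr_append[symmetric] by blast

lemma smooth_continuous: "smooth g \<Longrightarrow> continuous_on A (foldr partial_deriv js g)"
  unfolding smooth_def using continuous_on_subset by blast

lemma foldr_partial_deriv_diff:
  assumes "smooth u" "smooth v"
  shows "foldr partial_deriv js (\<lambda>x. u x - v x)
    = (\<lambda>x. foldr partial_deriv js u x - foldr partial_deriv js v x)"
proof (induction js)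
  case (Cons j js)
  have "((\<lambda>t. foldr partial_deriv js u (x + t *\<^sub>R axis j 1) - foldr partial_deriv js v (x + t *\<^sub>R axis j 1))
      has_vector_derivative (foldr partial_deriv (j # js) u x - foldr partial_deriv (j # js) v x)) (at 0)" for x
    by (intro has_vector_derivative_diff partial_deriv_has_vector_derivative assms)
  then have "partial_deriv j (\<lambda>x. foldr partial_deriv js u x - foldr partial_deriv js v x) x
      = foldr partial_deriv (j # js) u x - foldr partial_deriv (j # js) v x" for x
    unfolding partial_deriv_def[of j "\<lambda>x. _ x - _ x"] by (rule vector_derivative_at)
  then show ?case
    by (simp add: Cons fun_eq_iff)
qed auto

lemma smooth_diff:
  assumes "smooth u" "smooth v"
  shows "smooth (\<lambda>x. u x - v x)"
  unfolding smooth_def foldr_partial_deriv_diff[OF assms]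
  using assms by (auto simp: smooth_def intro!: continuous_intros)

lemma smooth_torus_partial_deriv:
  assumes "smooth_torus g"
  shows "smooth_torus (partial_deriv j g)"
proof -
  have "partial_deriv j g (x + axis i 1) = partial_deriv j g x" for i x
  proof -
    have "g (x + axis i 1 + t *\<^sub>R axis j 1) = g (x + t *\<^sub>R axis j 1)" for t
      using assms unfolding smooth_torus_def by (metis add.assoc add.commute)
    then show ?thesis by (simp add: partial_deriv_def)
  qed
  then show ?thesis
    using assms smooth_foldr[of g "[j]"] by (simp add: smooth_torus_def)
qed

text \<open>
  Integration by parts: the product of \<open>g\<close> with a character is periodic, so its derivative integrates
  to \<open>0\<close>.
\<close>

lemma fourier_coeff_partial_deriv:
  assumes g: "smooth_torus g"
  shows "fourier_coeff (partial_deriv j g) k = - (2 * pi * \<i> * of_int (k $ j)) * fourier_coeff g k"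
proof -
  let ?c = "2 * pi * \<i> * of_int (k $ j)"
  have sm: "smooth g" using g by (simp add: smooth_torus_def)
  have c0: "continuous_on A g" and c1: "continuous_on A (partial_deriv j g)" for A
    using smooth_continuous[OF sm, of A "[]"] smooth_continuous[OF sm, of A "[j]"] by auto
  have int: "f integrable_on cbox 0 1" if "continuous_on UNIV f" for f :: "real ^ 'a \<Rightarrow> complex"
    by (rule integrable_continuous) (rule continuous_on_subset[OF that subset_UNIV])
  have char: "((\<lambda>t. torus_char k (\<xi> + t *\<^sub>R axis j 1)) has_vector_derivative ?c * torus_char k \<xi>) (at 0)" for \<xi>
    unfolding torus_char_shift
    by (auto intro!: derivative_eq_intros has_vector_derivative_real_field
          simp: has_vector_derivative_def[symmetric] algebra_simps)
  have "((\<lambda>t. torus_char k (\<xi> + t *\<^sub>R axis j 1) * g (\<xi> + t *\<^sub>R axis j 1)) has_vector_derivative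
      ?c * (torus_char k \<xi> * g \<xi>) + torus_char k \<xi> * partial_deriv j g \<xi>) (at 0)" for \<xi>
    using has_vector_derivative_mult[OF char partial_deriv_has_vector_derivative[OF sm, of "[]"]]
    by (simp add: algebra_simps)
  then have "integral (cbox 0 1) (\<lambda>\<xi>. ?c * (torus_char k \<xi> * g \<xi>) + torus_char k \<xi> * partial_deriv j g \<xi>) = 0"
    using g
    by (intro integral_unit_cube_derivative[where h = "\<lambda>\<xi>. torus_char k \<xi> * g \<xi>" and j = j])
       (auto intro!: continuous_intros continuous_on_torus_char c0 c1
         simp: torus_char_periodic smooth_torus_def)
  then have "?c * fourier_coeff g k + fourier_coeff (partial_deriv j g) k = 0"
    unfolding fourier_coeff_def
    by (subst (asm) integral_add)
       (auto intro!: int continuous_intros continuous_on_torus_char c0 c1)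
  then show ?thesis by (simp add: add_eq_0_iff)
qed

lemma fourier_coeff_partial_deriv_power:
  assumes g: "smooth_torus g"
  shows "smooth_torus ((partial_deriv j ^^ b) g)"
    and "fourier_coeff ((partial_deriv j ^^ b) g) k
      = (- (2 * pi * \<i> * of_int (k $ j))) ^ b * fourier_coeff g k"
proof (induction b)
  case (Suc b)
  { case 1 show ?case using Suc(1) by (simp add: smooth_torus_partial_deriv) }
  { case 2 show ?case using Suc by (simp add: fourier_coeff_partial_deriv) }
qed (use g in auto)

section \<open>Differences under linear functionals, and the multi-indices that matter\<close>

text \<open>
  A difference in the lattice variable is a linear combination of lattice translates, hence commutes
  with every functional that acts on the other variable. This moves differences past derivatives in
  \<open>\<xi>\<close> and past Fourier coefficients at once.
\<close>

lemma foldr_partial_diff_functional: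
  fixes \<Phi> :: "('x \<Rightarrow> complex) \<Rightarrow> complex"
  assumes add: "\<And>u v. P u \<Longrightarrow> P v \<Longrightarrow> \<Phi> (\<lambda>x. u x - v x) = \<Phi> u - \<Phi> v"
    and closed: "\<And>u v. P u \<Longrightarrow> P v \<Longrightarrow> P (\<lambda>x. u x - v x)"
    and \<sigma>: "\<And>k. P (\<sigma> k)"
  shows "P (\<lambda>x. foldr partial_diff ds (\<lambda>l. \<sigma> l x) k) \<and>
    \<Phi> (\<lambda>x. foldr partial_diff ds (\<lambda>l. \<sigma> l x) k) = foldr partial_diff ds (\<lambda>l. \<Phi> (\<sigma> l)) k"
proof (induction ds arbitrary: k)
  case (Cons d ds)
  then show ?case using Cons.IH closed add by (simp add: partial_diff_def)
qed (use \<sigma> in auto)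

lemma foldr_funpow_coords:
  assumes "distinct js"
  shows "foldr (\<lambda>i. D i ^^ (if i = j then b else 0)) js x = (if j \<in> set js then (D j ^^ b) x else x)"
  using assms by (induction js) auto

text \<open>
  Only two kinds of multi-indices are needed: multiples of a unit vector for derivatives, and
  indicators of sets of coordinates for differences.
\<close>

lemma mi_power_single: "mi_power D (\<chi> i. if i = j then b else 0) = D j ^^ b"
  using foldr_funpow_coords[OF distinct_coords, where D = D and j = j and b = b]
  by (simp add: mi_power_def fun_eq_iff set_coords)

lemma foldr_funpow_filter:
  "foldr (\<lambda>i. D i ^^ (if i \<in> S then 1 else 0)) js x = foldr D (filter (\<lambda>i. i \<in> S) js) x"
  by (induction js) auto

lemma mi_power_indicator:
  "mi_power D (\<chi> i. if i \<in> S then 1 else 0) = foldr D (filter (\<lambda>i. i \<in> S) coords)"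
  using foldr_funpow_filter[where D = D and S = S and js = coords] by (simp add: mi_power_def fun_eq_iff)

lemma mi_order_single: "mi_order (\<chi> i. if i = j then b else 0) = b"
  by (simp add: mi_order_def)

lemma mi_order_indicator: "mi_order (\<chi> i. if i \<in> S then 1 else 0) = card S"
  by (simp add: mi_order_def sum.If_cases)

section \<open>Restriction of a family of functions to the diagonal\<close>

lemma L2_set_sum_le:
  assumes "finite I"
  shows "L2_set (\<lambda>x. \<Sum>t\<in>I. f t x) X \<le> (\<Sum>t\<in>I. L2_set (f t) X)"
  using assms
proof (induction I)
  case (insert t I)
  have "L2_set (\<lambda>x. f t x + (\<Sum>t\<in>I. f t x)) X \<le> L2_set (f t) X + L2_set (\<lambda>x. \<Sum>t\<in>I. f t x) X"
    by (rule L2_set_triangle_ineq)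
  then show ?case using insert by simp
qed (simp add: L2_set_def)

lemma sum_telescope_int:
  fixes f :: "int \<Rightarrow> 'a::ab_group_add"
  assumes "a \<le> b"
  shows "(\<Sum>t\<in>{a..<b}. f (t + 1) - f t) = f b - f a"
  using assms
proof (induction b rule: int_ge_induct)
  case (step i)
  then have "{a..<i + 1} = insert i {a..<i}" by auto
  with step show ?case by simp
qed simp

definition lattice_box :: "int ^ 'n::finite \<Rightarrow> nat \<Rightarrow> (int ^ 'n) set" where
  "lattice_box c L = {k. \<forall>j. c $ j \<le> k $ j \<and> k $ j < c $ j + int L}"

text \<open>
  A discrete form of the Sobolev embedding. In \<open>F k x\<close> the parameter \<open>k\<close> is frozen to \<open>y\<close>, except in the
  coordinates \<open>js\<close>, where it follows \<open>x\<close>. To release one more coordinate \<open>j\<close>, telescope along \<open>j\<close> from the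
  corner \<open>c\<close> to \<open>x\<close>. This bounds the function by its value with \<open>j\<close> frozen to \<open>c $ j\<close> and the sum
  of its differences with \<open>j\<close> frozen to \<open>t\<close>. There are at most \<open>L\<close> values of \<open>t\<close>,
  and the induction hypothesis for each difference gains \<open>1 / L\<close>; both contributions are thus equal, which explains the factor \<open>2\<close> per coordinate.

  Coordinates are appended at the end of the list, because the last operator of the list is the first
  one that \<open>foldr\<close> applies: the induction hypothesis is then used for the difference of \<open>F\<close> itself and
  differences never have to be interchanged.
\<close>

lemma discrete_sobolev_partial:
  fixes F :: "int ^ 'n::finite \<Rightarrow> int ^ 'n \<Rightarrow> complex"
  assumes L: "1 \<le> L" and X: "X \<subseteq> lattice_box c L" and js: "distinct js"
    and F: "\<And>S k. S \<subseteq> set js \<Longrightarrow> k \<in> lattice_box c L \<Longrightarrow>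
      L2_set (\<lambda>x. cmod (foldr partial_diff (filter (\<lambda>i. i \<in> S) js) (\<lambda>l. F l x) k)) X \<le> A / real L ^ card S"
    and y: "y \<in> lattice_box c L"
  shows "L2_set (\<lambda>x. cmod (F (\<chi> i. if i \<in> set js then x $ i else y $ i) x)) X \<le> 2 ^ length js * A"
  using js F y
proof (induction js arbitrary: F A y rule: rev_induct)
  case Nil
  from Nil.prems(2)[of "{}" y] Nil.prems(3) show ?case by simp
next
  case (snoc j js)
  \<comment> \<open>\<open>M x t\<close> follows \<open>x\<close> in the coordinates \<open>js\<close>, is \<open>t\<close> in the coordinate \<open>j\<close>, and is frozen to \<open>y\<close> elsewhere.\<close>
  define z where "z t = (\<chi> i. if i = j then t else y $ i)" for t
  define M where "M x t = (\<chi> i. if i \<in> set js then x $ i else z t $ i)" for x t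
  define G where "G l x = partial_diff j (\<lambda>l. F l x) l" for l x
  have js: "distinct js" and j: "j \<notin> set js" using snoc.prems by auto
  have z: "z t \<in> lattice_box c L" if "t \<in> {c $ j..<c $ j + int L}" for t
    using that snoc.prems(3) by (auto simp: z_def lattice_box_def)
  have M_step: "M x t + axis j 1 = M x (t + 1)" for x t
    using j by (auto simp: M_def z_def vec_eq_iff axis_def)
  have F0: "L2_set (\<lambda>x. cmod (F (M x (c $ j)) x)) X \<le> 2 ^ length js * A"
    unfolding M_def
  proof (rule snoc.IH[OF js])
    fix S k assume S: "S \<subseteq> set js" and k: "k \<in> lattice_box c L"
    then have "filter (\<lambda>i. i \<in> S) (js @ [j]) = filter (\<lambda>i. i \<in> S) js" using j by auto
    then show "L2_set (\<lambda>x. cmod (foldr partial_diff (filter (\<lambda>i. i \<in> S) js) (\<lambda>l. F l x) k)) X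
        \<le> A / real L ^ card S"
      using snoc.prems(2)[of S k] S k by auto
  qed (use z L in auto)
  have G: "L2_set (\<lambda>x. cmod (G (M x t) x)) X \<le> 2 ^ length js * (A / L)"
    if t: "t \<in> {c $ j..<c $ j + int L}" for t
    unfolding M_def
  proof (rule snoc.IH[OF js])
    fix S k assume S: "S \<subseteq> set js" and k: "k \<in> lattice_box c L"
    have "filter (\<lambda>i. i \<in> insert j S) js = filter (\<lambda>i. i \<in> S) js"
      using j by (intro filter_cong) auto
    then have "filter (\<lambda>i. i \<in> insert j S) (js @ [j]) = filter (\<lambda>i. i \<in> S) js @ [j]" by simp
    moreover have "card (insert j S) = Suc (card S)"
      using S j finite_subset[OF S] by (subst card_insert_disjoint) auto
    ultimately show "L2_set (\<lambda>x. cmod (foldr partial_diff (filter (\<lambda>i. i \<in> S) js) (\<lambda>l. G l x) k)) X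
        \<le> A / real L / real L ^ card S"
      using snoc.prems(2)[of "insert j S" k] S k by (auto simp: G_def[abs_def])
  qed (use z t in auto)
  have telescope: "cmod (F (\<chi> i. if i \<in> set (js @ [j]) then x $ i else y $ i) x)
      \<le> cmod (F (M x (c $ j)) x) + (\<Sum>t\<in>{c $ j..<c $ j + int L}. cmod (G (M x t) x))"
    if "x \<in> X" for x
  proof -
    have xj: "c $ j \<le> x $ j" "x $ j < c $ j + int L" using that X by (auto simp: lattice_box_def)
    have "(\<chi> i. if i \<in> set (js @ [j]) then x $ i else y $ i) = M x (x $ j)"
      by (auto simp: M_def z_def vec_eq_iff)
    moreover have "F (M x (x $ j)) x = F (M x (c $ j)) x + (\<Sum>t\<in>{c $ j..<x $ j}. G (M x t) x)"
      using sum_telescope_int[OF xj(1), of "\<lambda>t. F (M x t) x"] by (simp add: G_def partial_diff_def M_step)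
    moreover have "cmod (\<Sum>t\<in>{c $ j..<x $ j}. G (M x t) x) \<le> (\<Sum>t\<in>{c $ j..<x $ j}. cmod (G (M x t) x))"
      by (rule norm_sum)
    moreover have "\<dots> \<le> (\<Sum>t\<in>{c $ j..<c $ j + int L}. cmod (G (M x t) x))"
      using xj by (intro sum_mono2) auto
    ultimately show ?thesis by (smt (verit) norm_triangle_ineq)
  qed
  have "L2_set (\<lambda>x. cmod (F (\<chi> i. if i \<in> set (js @ [j]) then x $ i else y $ i) x)) X
      \<le> L2_set (\<lambda>x. cmod (F (M x (c $ j)) x) + (\<Sum>t\<in>{c $ j..<c $ j + int L}. cmod (G (M x t) x))) X"
    by (intro L2_set_mono telescope) auto
  also have "\<dots> \<le> L2_set (\<lambda>x. cmod (F (M x (c $ j)) x)) X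
      + L2_set (\<lambda>x. \<Sum>t\<in>{c $ j..<c $ j + int L}. cmod (G (M x t) x)) X"
    by (rule L2_set_triangle_ineq)
  also have "\<dots> \<le> 2 ^ length js * A + (\<Sum>t\<in>{c $ j..<c $ j + int L}. 2 ^ length js * (A / L))"
    by (intro add_mono F0 order_trans[OF L2_set_sum_le] sum_mono G) auto
  also have "\<dots> = 2 ^ length (js @ [j]) * A" using L by simp
  finally show ?case .
qed

text \<open>
  A bound for the family at each fixed parameter \<open>k\<close> of a box, together with its differences, controls
  the diagonal \<open>F x x\<close>. A pseudo-differential operator with frozen symbol is a Fourier multiplier, and
  the diagonal restores the operator itself.
\<close>

lemma discrete_sobolev:
  fixes F :: "int ^ 'n::finite \<Rightarrow> int ^ 'n \<Rightarrow> complex"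
  assumes "1 \<le> L" and "X \<subseteq> lattice_box c L"
    and "\<And>S k. k \<in> lattice_box c L \<Longrightarrow>
      L2_set (\<lambda>x. cmod (foldr partial_diff (filter (\<lambda>i. i \<in> S) coords) (\<lambda>l. F l x) k)) X \<le> A / real L ^ card S"
  shows "L2_set (\<lambda>x. cmod (F x x)) X \<le> 2 ^ CARD('n) * A"
proof -
  have "c \<in> lattice_box c L" using assms(1) by (simp add: lattice_box_def)
  moreover have "length (coords :: 'n list) = CARD('n)"
    using distinct_card[OF distinct_coords[where 'n='n]] by (simp add: set_coords)
  ultimately show ?thesis
    using discrete_sobolev_partial[OF assms(1,2) distinct_coords assms(3)] by (simp add: set_coords)
qed

section \<open>Lattice sums\<close>

text \<open>
  Comparing \<open>y\<close> with its integer part reduces the claim to the convergence of \<open>\<Sum>n. 1 / (1 + n\<^sup>2)\<close>.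
\<close>

lemma sum_inverse_square_int_bounded:
  "\<exists>C. \<forall>F y. finite F \<longrightarrow> (\<Sum>t\<in>F. 1 / (1 + (y - real_of_int t)\<^sup>2)) \<le> C"
proof -
  define \<phi> where "\<phi> n = 1 / (1 + (real n)\<^sup>2)" for n
  have "summable (\<lambda>n. 1 / (real n)\<^sup>2)"
    using inverse_power_summable[of 2, where 'a = real] by (simp add: inverse_eq_divide)
  then have "summable (\<lambda>n. 1 / (real (Suc n))\<^sup>2)"
    by (subst summable_Suc_iff)
  then have "summable (\<lambda>n. \<phi> (Suc n))"
    by (rule summable_comparison_test') (auto simp: \<phi>_def intro!: divide_left_mono mult_pos_pos add_pos_nonneg)
  then have summ: "summable \<phi>" by (subst (asm) summable_Suc_iff)
  have nat_bound: "(\<Sum>u\<in>G. \<phi> (nat \<bar>u\<bar>)) \<le> suminf \<phi>" if "finite G" "inj_on (\<lambda>u. nat \<bar>u\<bar>) G" for G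
  proof -
    have "(\<Sum>u\<in>G. \<phi> (nat \<bar>u\<bar>)) = (\<Sum>n\<in>(\<lambda>u. nat \<bar>u\<bar>) ` G. \<phi> n)"
      using that by (simp add: sum.reindex)
    also have "\<dots> \<le> suminf \<phi>"
      using that by (intro sum_le_suminf summ) (auto simp: \<phi>_def)
    finally show ?thesis .
  qed
  have "(\<Sum>t\<in>F. 1 / (1 + (y - real_of_int t)\<^sup>2)) \<le> 6 * suminf \<phi>" if F: "finite F" for F y
  proof -
    let ?G = "(\<lambda>t. t - \<lfloor>y\<rfloor>) ` F"
    \<comment> \<open>\<open>u \<mapsto> nat \<bar>u\<bar>\<close> is injective on each of the two halves.\<close>
    have split: "?G = {u\<in>?G. 0 \<le> u} \<union> {u\<in>?G. u < 0}" by auto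
    have term_le: "1 / (1 + (y - real_of_int t)\<^sup>2) \<le> 3 * \<phi> (nat \<bar>t - \<lfloor>y\<rfloor>\<bar>)" for t
    proof -
      define a where "a = y - real_of_int t"
      define d where "d = y - real_of_int \<lfloor>y\<rfloor>"
      have d: "0 \<le> d" "d \<le> 1" unfolding d_def by linarith+
      have "real (nat \<bar>t - \<lfloor>y\<rfloor>\<bar>) = \<bar>d - a\<bar>" by (simp add: a_def d_def)
      then have "1 + (real (nat \<bar>t - \<lfloor>y\<rfloor>\<bar>))\<^sup>2 = 1 + (d - a)\<^sup>2" by simp
      also have "\<dots> \<le> 3 * (1 + a\<^sup>2)"
      proof -
        have "(d - a)\<^sup>2 + (d + a)\<^sup>2 = 2 * d\<^sup>2 + 2 * a\<^sup>2" by (simp add: power2_eq_square algebra_simps)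
        moreover have "d\<^sup>2 \<le> 1" using d by (simp add: power_le_one)
        ultimately show ?thesis using zero_le_power2[of "d + a"] zero_le_power2[of a] by argo
      qed
      finally have *: "1 + (real (nat \<bar>t - \<lfloor>y\<rfloor>\<bar>))\<^sup>2 \<le> 3 * (1 + a\<^sup>2)" .
      have "0 < 1 + a\<^sup>2" "0 < 1 + (real (nat \<bar>t - \<lfloor>y\<rfloor>\<bar>))\<^sup>2" by (simp_all add: add_pos_nonneg)
      with * show ?thesis unfolding \<phi>_def a_def[symmetric] by (simp add: divide_simps mult.commute)
    qed
    have "(\<Sum>t\<in>F. 1 / (1 + (y - real_of_int t)\<^sup>2)) \<le> (\<Sum>t\<in>F. 3 * \<phi> (nat \<bar>t - \<lfloor>y\<rfloor>\<bar>))"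
      by (intro sum_mono term_le)
    also have "\<dots> = 3 * (\<Sum>u\<in>?G. \<phi> (nat \<bar>u\<bar>))"
      by (simp add: sum_distrib_left sum.reindex inj_on_def)
    also have "(\<Sum>u\<in>?G. \<phi> (nat \<bar>u\<bar>)) = (\<Sum>u\<in>{u\<in>?G. 0 \<le> u}. \<phi> (nat \<bar>u\<bar>)) + (\<Sum>u\<in>{u\<in>?G. u < 0}. \<phi> (nat \<bar>u\<bar>))"
      by (subst split, rule sum.union_disjoint) (use F in auto)
    also have "3 * \<dots> \<le> 3 * (suminf \<phi> + suminf \<phi>)"
      using F by (intro mult_left_mono add_mono nat_bound) (auto simp: inj_on_def)
    finally show ?thesis by simp
  qed
  then show ?thesis by blast
qed

text \<open>
  A finite set of lattice points lies in the product of its projections to the axes.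
\<close>

lemma sum_prod_vec_le:
  fixes F :: "(int ^ 'n::finite) set" and \<phi> :: "'n \<Rightarrow> int \<Rightarrow> real"
  assumes "finite F" and "\<And>j t. 0 \<le> \<phi> j t"
  shows "(\<Sum>q\<in>F. \<Prod>j\<in>UNIV. \<phi> j (q $ j)) \<le> (\<Prod>j\<in>UNIV. \<Sum>t\<in>(\<lambda>q. q $ j) ` F. \<phi> j t)"
proof -
  have "(\<Sum>q\<in>F. \<Prod>j\<in>UNIV. \<phi> j (q $ j)) = (\<Sum>g\<in>vec_nth ` F. \<Prod>j\<in>UNIV. \<phi> j (g j))"
    by (subst sum.reindex) (auto simp: inj_on_def vec_nth_inject)
  also have "\<dots> \<le> (\<Sum>g\<in>PiE UNIV (\<lambda>j. (\<lambda>q. q $ j) ` F). \<Prod>j\<in>UNIV. \<phi> j (g j))"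
    using assms by (intro sum_mono2 finite_PiE prod_nonneg) auto
  also have "\<dots> = (\<Prod>j\<in>UNIV. \<Sum>t\<in>(\<lambda>q. q $ j) ` F. \<phi> j t)"
    using assms by (intro prod_sum_PiE[symmetric]) auto
  finally show ?thesis .
qed

lemma lattice_sum_bounded:
  "\<exists>C\<ge>0. \<forall>F (y :: real ^ 'n::finite). finite F \<longrightarrow>
    (\<Sum>q\<in>F. \<Prod>j\<in>UNIV. 1 / (1 + (y $ j - real_of_int (q $ j))\<^sup>2)) \<le> C"
proof -
  obtain C where C: "(\<Sum>t\<in>F. 1 / (1 + (y - real_of_int t)\<^sup>2)) \<le> C" if "finite F" for F y
    using sum_inverse_square_int_bounded by blast
  have "0 \<le> C" using C[of "{}"] by simp
  moreover have "(\<Sum>q\<in>F. \<Prod>j\<in>UNIV. 1 / (1 + (y $ j - real_of_int (q $ j))\<^sup>2)) \<le> C ^ CARD('n)"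
    if "finite F" for F :: "(int ^ 'n) set" and y :: "real ^ 'n"
  proof -
    have "(\<Sum>q\<in>F. \<Prod>j\<in>UNIV. 1 / (1 + (y $ j - real_of_int (q $ j))\<^sup>2))
        \<le> (\<Prod>j\<in>UNIV. \<Sum>t\<in>(\<lambda>q. q $ j) ` F. 1 / (1 + (y $ j - real_of_int t)\<^sup>2))"
      using that by (rule sum_prod_vec_le) auto
    also have "\<dots> \<le> (\<Prod>j\<in>(UNIV :: 'n set). C)"
      using that by (intro prod_mono conjI C sum_nonneg) auto
    finally show ?thesis by simp
  qed
  ultimately show ?thesis by (intro exI[of _ "C ^ CARD('n)"]) auto
qed

text \<open>
  The \<open>n\<close>-th power of each factor on the left is at most the right-hand side; hence so is the \<open>n\<close>-th power
  of their geometric mean, which is the product.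
\<close>

lemma prod_one_plus_square_le:
  fixes y :: "real ^ 'n::finite"
  assumes M: "CARD('n) \<le> M"
  shows "(\<Prod>j\<in>UNIV. 1 + (y $ j)\<^sup>2) \<le> 2 ^ M * (1 + (\<Sum>j\<in>UNIV. (y $ j) ^ (2 * M)))"
proof -
  let ?P = "1 + (\<Sum>j\<in>UNIV. (y $ j) ^ (2 * M))"
  have nonneg: "0 \<le> (y $ j) ^ (2 * M)" for j by (simp add: power_mult)
  have factor: "(1 + (y $ j)\<^sup>2) ^ CARD('n) \<le> 2 ^ M * ?P" for j
  proof -
    define x where "x = (y $ j)\<^sup>2"
    have x: "0 \<le> x" by (simp add: x_def)
    have "(1 + x) ^ CARD('n) \<le> (1 + x) ^ M" using x M by (intro power_increasing) auto
    also have "\<dots> \<le> (2 * max 1 x) ^ M" using x by (intro power_mono) auto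
    also have "\<dots> \<le> 2 ^ M * (1 + x ^ M)"
      using x by (auto simp: power_mult_distrib max_def)
    also have "x ^ M = (y $ j) ^ (2 * M)" by (simp add: x_def power_mult)
    also have "(y $ j) ^ (2 * M) \<le> (\<Sum>j\<in>UNIV. (y $ j) ^ (2 * M))"
      using nonneg by (intro member_le_sum) auto
    finally show ?thesis by (simp add: x_def)
  qed
  have "(\<Prod>j\<in>UNIV. 1 + (y $ j)\<^sup>2) ^ CARD('n) = (\<Prod>j\<in>UNIV. (1 + (y $ j)\<^sup>2) ^ CARD('n))"
    by (rule prod_power_distrib)
  also have "\<dots> \<le> (\<Prod>j\<in>(UNIV :: 'n set). 2 ^ M * ?P)"
    by (intro prod_mono conjI factor) auto
  also have "\<dots> = (2 ^ M * ?P) ^ CARD('n)" by simp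
  finally show ?thesis
    by (rule power_le_imp_le_base[of _ "CARD('n) - 1", simplified]) (simp add: nonneg sum_nonneg add_nonneg_nonneg)
qed

section \<open>A dyadic decomposition of the lattice into boxes\<close>

definition dyadic_level :: "int ^ 'n::finite \<Rightarrow> nat" where
  "dyadic_level k = nat \<lfloor>log 2 (1 + norm (lattice_vec k))\<rfloor>"

text \<open>
  The divisor \<open>4 * n\<close> keeps the diameter of a box of side at least two below a quarter of
  \<open>2 ^ s\<close>; the remaining boxes are single points. Hence \<open>1 + norm\<close> is comparable with \<open>2 ^ s\<close> on every
  box that meets the dyadic shell of level \<open>s\<close>, even where the box leaves the shell.
\<close>

definition box_side :: "real \<Rightarrow> nat \<Rightarrow> nat \<Rightarrow> nat" where
  "box_side \<rho> n s = max 1 (nat \<lfloor>2 powr (real s * \<rho>) / (4 * real n)\<rfloor>)"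

text \<open>
  The boxes of one level \<open>s\<close> tile the lattice, and a box is named by \<open>s\<close> and its position \<open>q\<close> in the
  tiling. A lattice point is assigned to the box of its own level that contains it.
\<close>

definition box_index :: "real \<Rightarrow> int ^ 'n::finite \<Rightarrow> nat \<times> (int ^ 'n)" where
  "box_index \<rho> k = (dyadic_level k, \<chi> j. k $ j div int (box_side \<rho> CARD('n) (dyadic_level k)))"

definition box_corner :: "real \<Rightarrow> nat \<times> (int ^ 'n::finite) \<Rightarrow> int ^ 'n" where
  "box_corner \<rho> i = (\<chi> j. int (box_side \<rho> CARD('n) (fst i)) * snd i $ j)"

definition box_of :: "real \<Rightarrow> nat \<times> (int ^ 'n::finite) \<Rightarrow> (int ^ 'n) set" where
  "box_of \<rho> i = lattice_box (box_corner \<rho> i) (box_side \<rho> CARD('n) (fst i))"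

text \<open>
  The weight is a sum of powers of single coordinates, so that only pure derivatives of the symbol arise
  when it is expanded; the even exponent makes it at least one.
\<close>

definition box_weight :: "real \<Rightarrow> nat \<Rightarrow> nat \<times> (int ^ 'n::finite) \<Rightarrow> int ^ 'n \<Rightarrow> real" where
  "box_weight \<rho> M i l =
    1 + (\<Sum>j\<in>UNIV. (real_of_int (l $ j - box_corner \<rho> i $ j) / box_side \<rho> CARD('n) (fst i)) ^ (2 * M))"

lemma dyadic_level:
  shows "2 ^ dyadic_level k \<le> 1 + norm (lattice_vec k)"
    and "1 + norm (lattice_vec k) < 2 * 2 ^ dyadic_level k"
proof -
  let ?x = "1 + norm (lattice_vec k)"
  have "0 \<le> log 2 ?x" by (simp add: add_pos_nonneg)
  then have f: "real (dyadic_level k) = of_int \<lfloor>log 2 ?x\<rfloor>" unfolding dyadic_level_def by simp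
  have "2 powr real (dyadic_level k) \<le> 2 powr (log 2 ?x)" unfolding f by simp
  then show "2 ^ dyadic_level k \<le> ?x" by (simp add: powr_realpow add_pos_nonneg)
  have "2 powr (log 2 ?x) < 2 powr (real (Suc (dyadic_level k)))"
    using f by (intro powr_less_mono) linarith+
  also have "\<dots> = 2 ^ Suc (dyadic_level k)" by (rule powr_realpow) simp
  finally show "?x < 2 * 2 ^ dyadic_level k" by (simp add: add_pos_nonneg)
qed

lemma box_side:
  assumes "0 \<le> \<rho>" "\<rho> \<le> 1" "1 \<le> n"
  shows box_side_ge_1: "1 \<le> box_side \<rho> n s"
    and box_side_le: "real (box_side \<rho> n s) \<le> 2 powr (real s * \<rho>)"
    and le_box_side: "2 powr (real s * \<rho>) \<le> 8 * real n * real (box_side \<rho> n s)"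
    and box_diameter: "real n * (real (box_side \<rho> n s) - 1) \<le> 2 ^ s / 4"
proof -
  define w where "w = 2 powr (real s * \<rho>)"
  define L where "L = box_side \<rho> n s"
  have w1: "1 \<le> w" unfolding w_def using assms by (simp add: ge_one_powr_ge_zero)
  have "w \<le> 2 powr real s" unfolding w_def using assms
    by (intro powr_mono mult_left_le) auto
  then have w2: "w \<le> 2 ^ s" by (simp add: powr_realpow)
  have quot: "0 \<le> w / (4 * real n)" using w1 by simp
  have L_def': "L = max 1 (nat \<lfloor>w / (4 * real n)\<rfloor>)" by (simp add: L_def box_side_def w_def)
  then show L1: "1 \<le> L" by simp
  have "real (nat \<lfloor>w / (4 * real n)\<rfloor>) \<le> w / (4 * real n)" using quot by (simp add: of_nat_floor)
  moreover have "w / (4 * real n) \<le> w" using w1 assms by (simp add: divide_simps)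
  ultimately have "real (nat \<lfloor>w / (4 * real n)\<rfloor>) \<le> w" by (rule order_trans)
  then show "real L \<le> w" using w1 unfolding L_def' by (simp only: of_nat_max of_nat_1 max.bounded_iff)
  have "w / (4 * real n) < real (nat \<lfloor>w / (4 * real n)\<rfloor>) + 1" using quot by linarith
  also have "\<dots> \<le> 2 * real L" unfolding L_def' by (simp add: max_def)
  finally show "w \<le> 8 * real n * real L" using assms by (simp add: divide_simps mult_ac)
  show "real n * (real L - 1) \<le> 2 ^ s / 4"
  proof (cases "L = 1")
    case False
    then have "real L \<le> w / (4 * real n)"
      using quot unfolding L_def' by (auto simp: max_def of_nat_floor)
    then have "real n * real L \<le> w / 4" using assms by (simp add: divide_simps mult_ac)
    then show ?thesis using w2 by (simp add: algebra_simps)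
  qed simp
qed

lemma norm_lattice_box_diff_le:
  fixes k k' :: "int ^ 'n::finite"
  assumes "k \<in> lattice_box c L" "k' \<in> lattice_box c L"
  shows "norm (lattice_vec k - lattice_vec k') \<le> real CARD('n) * (real L - 1)"
proof -
  have "norm (lattice_vec k - lattice_vec k') \<le> (\<Sum>j\<in>UNIV. \<bar>(lattice_vec k - lattice_vec k') $ j\<bar>)"
    by (rule norm_le_l1_cart)
  also have "\<dots> \<le> (\<Sum>j\<in>(UNIV :: 'n set). real L - 1)"
  proof (intro sum_mono)
    fix j
    have "\<bar>k $ j - k' $ j\<bar> \<le> int L - 1" using assms unfolding lattice_box_def by (auto dest!: spec[of _ j])
    then have "real_of_int \<bar>k $ j - k' $ j\<bar> \<le> real_of_int (int L - 1)" by (simp only: of_int_le_iff)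
    then show "\<bar>(lattice_vec k - lattice_vec k') $ j\<bar> \<le> real L - 1" by simp
  qed
  also have "\<dots> = real CARD('n) * (real L - 1)" by simp
  finally show ?thesis .
qed

lemma box_of_index:
  fixes k :: "int ^ 'n::finite"
  assumes "0 \<le> \<rho>" "\<rho> \<le> 1"
  shows "k \<in> box_of \<rho> (box_index \<rho> k)"
proof -
  define L where "L = int (box_side \<rho> CARD('n) (dyadic_level k))"
  have L: "0 < L" using box_side_ge_1[OF assms, of "CARD('n)" "dyadic_level k"] by (simp add: L_def Suc_le_eq)
  have "L * (k $ j div L) \<le> k $ j \<and> k $ j < L * (k $ j div L) + L" for j
    using pos_mod_bound[OF L, of "k $ j"] pos_mod_sign[OF L, of "k $ j"]
      mult_div_mod_eq[of L "k $ j"] by linarith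
  then show ?thesis
    by (simp add: box_of_def lattice_box_def box_corner_def box_index_def L_def)
qed

lemma norm_box_of_diff_le:
  fixes k k' :: "int ^ 'n::finite"
  assumes "0 \<le> \<rho>" "\<rho> \<le> 1" and "k' \<in> box_of \<rho> (box_index \<rho> k)"
  shows "norm (lattice_vec k' - lattice_vec k) \<le> 2 ^ dyadic_level k / 4"
  using norm_lattice_box_diff_le[of k' _ _ k] box_of_index[OF assms(1,2), of k] assms(3)
    box_diameter[OF assms(1,2), of "CARD('n)" "dyadic_level k"]
  unfolding box_of_def by (fastforce simp: box_index_def)

text \<open>
  On a box the power of \<open>1 + norm k'\<close> that governs the symbol may be replaced by the side length.
\<close>

lemma box_side_comparable:
  fixes k k' :: "int ^ 'n::finite"
  assumes \<rho>: "0 \<le> \<rho>" "\<rho> \<le> 1" and k': "k' \<in> box_of \<rho> (box_index \<rho> k)"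
  defines "L \<equiv> real (box_side \<rho> CARD('n) (dyadic_level k))"
    and "\<kappa> \<equiv> 18 * real CARD('n)" and "W \<equiv> (1 + norm (lattice_vec k')) powr \<rho>"
  shows "L / \<kappa> \<le> W" and "W \<le> \<kappa> * L"
proof -
  \<comment> \<open>On the box \<open>1 + norm\<close> lies between \<open>3 / 4 * R\<close> and \<open>9 / 4 * R\<close>, and \<open>R powr \<rho>\<close> lies between \<open>L\<close> and \<open>8 * CARD('n) * L\<close>; the constant is \<open>18 = 9 / 4 * 8\<close>.\<close>
  define R :: real where "R = 2 ^ dyadic_level k"
  have R: "1 \<le> R" by (simp add: R_def)
  have n: "1 \<le> real CARD('n)" by (simp add: Suc_le_eq)
  have L1: "1 \<le> L" using box_side_ge_1[OF \<rho>, of "CARD('n)"] by (simp add: L_def)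
  have Rp: "R powr \<rho> = 2 powr (real (dyadic_level k) * \<rho>)"
    by (simp add: R_def powr_powr powr_realpow[symmetric])
  have d: "norm (lattice_vec k' - lattice_vec k) \<le> R / 4"
    using norm_box_of_diff_le[OF \<rho> k'] by (simp add: R_def)
  have tri: "norm (lattice_vec k') \<le> norm (lattice_vec k) + norm (lattice_vec k' - lattice_vec k)"
    "norm (lattice_vec k) \<le> norm (lattice_vec k') + norm (lattice_vec k' - lattice_vec k)"
    using norm_triangle_sub[of "lattice_vec k'" "lattice_vec k"]
      norm_triangle_sub[of "lattice_vec k" "lattice_vec k'"] by (simp_all add: norm_minus_commute)
  have up: "1 + norm (lattice_vec k') \<le> (9 / 4) * R" and low: "(3 / 4) * R \<le> 1 + norm (lattice_vec k')"
    using d tri dyadic_level[of k] unfolding R_def by linarith+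
  have "W \<le> ((9 / 4) * R) powr \<rho>" unfolding W_def using up \<rho> by (intro powr_mono2) auto
  also have "\<dots> = (9 / 4) powr \<rho> * R powr \<rho>" by (rule powr_mult)
  also have "\<dots> \<le> (9 / 4) powr 1 * (8 * real CARD('n) * L)"
    using \<rho> le_box_side[OF \<rho>, of "CARD('n)" "dyadic_level k"] unfolding Rp L_def
    by (intro mult_mono powr_mono) auto
  finally show "W \<le> \<kappa> * L" by (simp add: \<kappa>_def mult_ac)
  have "2 \<le> 27 * real CARD('n)" using n by linarith
  then have "L / \<kappa> \<le> (3 / 4) * L" using L1 by (simp add: \<kappa>_def divide_simps)
  also have "\<dots> \<le> (3 / 4) powr \<rho> * R powr \<rho>"
  proof (rule mult_mono)
    show "3 / 4 \<le> (3 / 4 :: real) powr \<rho>" using powr_mono'[of \<rho> 1 "3 / 4"] \<rho> by simp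
    show "L \<le> R powr \<rho>" using box_side_le[OF \<rho>, of "CARD('n)" "dyadic_level k"] unfolding Rp L_def by simp
  qed (use L1 in auto)
  also have "\<dots> = ((3 / 4) * R) powr \<rho>" by (rule powr_mult[symmetric])
  also have "\<dots> \<le> W" unfolding W_def using low \<rho> R by (intro powr_mono2) auto
  finally show "L / \<kappa> \<le> W" .
qed

lemma box_weight_ge_1: "1 \<le> box_weight \<rho> M i l"
  unfolding box_weight_def by (simp add: sum_nonneg power_mult)

text \<open>
  If the norms of \<open>l\<close> and of the points of the box are not comparable, then \<open>l\<close> has distance at least
  \<open>2 ^ s / 4\<close> from the corner of the box. Relative to the side, this distance is at least of order
  \<open>2 powr (s * (1 - \<rho>))\<close>, and \<open>M\<close> is chosen such that its \<open>2 * M\<close>-th power beats \<open>2 ^ s\<close>.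
\<close>

lemma box_weight_far:
  fixes l :: "int ^ 'n::finite" and k :: "int ^ 'n"
  assumes \<rho>: "0 \<le> \<rho>" "\<rho> < 1" and M: "1 \<le> 2 * real M * (1 - \<rho>)"
    and i: "box_index \<rho> k = i"
    and far: "\<not> (2 ^ fst i < 2 * (1 + norm (lattice_vec l)) \<and> 1 + norm (lattice_vec l) < 4 * 2 ^ fst i)"
  shows "1 / box_weight \<rho> M i l \<le> (4 * real CARD('n)) ^ (2 * M) / 2 ^ fst i"
proof -
  define s where "s = fst i"
  define R :: real where "R = 2 ^ s"
  define c where "c = box_corner \<rho> i"
  define L where "L = real (box_side \<rho> CARD('n) s)"
  define n where "n = real CARD('n)"
  have R1: "1 \<le> R" by (simp add: R_def)
  have s: "s = dyadic_level k" using i by (auto simp: s_def box_index_def)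
  have \<rho>1: "\<rho> \<le> 1" using \<rho> by simp
  have n: "1 \<le> n" by (simp add: n_def Suc_le_eq)
  have L1: "1 \<le> L" using box_side_ge_1[OF \<rho>(1) \<rho>1, of "CARD('n)"] by (simp add: L_def)
  have "c \<in> box_of \<rho> i" using L1 by (simp add: box_of_def lattice_box_def c_def L_def s_def)
  then have ck: "norm (lattice_vec c - lattice_vec k) \<le> R / 4"
    using norm_box_of_diff_le[OF \<rho>(1) \<rho>1] i by (auto simp: R_def s)
  have k: "R \<le> 1 + norm (lattice_vec k)" "1 + norm (lattice_vec k) < 2 * R"
    using dyadic_level[of k] by (auto simp: R_def s)
  have tri: "norm (lattice_vec l) \<le> norm (lattice_vec k) + norm (lattice_vec c - lattice_vec k)
        + norm (lattice_vec l - lattice_vec c)"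
      "norm (lattice_vec k) \<le> norm (lattice_vec l) + norm (lattice_vec c - lattice_vec k)
        + norm (lattice_vec l - lattice_vec c)"
    by (smt (verit) norm_triangle_sub norm_minus_commute)+
  have "2 * (1 + norm (lattice_vec l)) \<le> R \<or> 4 * R \<le> 1 + norm (lattice_vec l)"
    using far by (auto simp: R_def s_def)
  then have dist: "R / 4 \<le> norm (lattice_vec l - lattice_vec c)"
  proof
    assume "2 * (1 + norm (lattice_vec l)) \<le> R"
    then show ?thesis using tri(2) ck k(1) by argo
  next
    assume "4 * R \<le> 1 + norm (lattice_vec l)"
    then show ?thesis using tri(1) ck k(2) R1 by linarith
  qed
  obtain j where j: "R / (4 * n) \<le> \<bar>real_of_int (l $ j - c $ j)\<bar>"
  proof -
    have "\<exists>j. R / (4 * n) \<le> \<bar>real_of_int (l $ j - c $ j)\<bar>"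
    proof (rule ccontr)
      assume "\<not> ?thesis"
      then have "(\<Sum>j\<in>UNIV. \<bar>(lattice_vec l - lattice_vec c) $ j\<bar>) < (\<Sum>j\<in>(UNIV :: 'n set). R / (4 * n))"
        by (intro sum_strict_mono) (auto simp: not_le)
      also have "\<dots> = R / 4" using n by (simp add: n_def)
      finally show False using dist norm_le_l1_cart[of "lattice_vec l - lattice_vec c"] by linarith
    qed
    then show ?thesis using that by blast
  qed
  have LR: "L \<le> R powr \<rho>"
    using box_side_le[OF \<rho>(1) \<rho>1, of "CARD('n)" s]
    by (simp add: L_def R_def powr_powr powr_realpow[symmetric])
  have "R / (4 * n) ^ (2 * M) \<le> R powr (2 * real M * (1 - \<rho>)) / (4 * n) ^ (2 * M)"
    using powr_mono[OF M R1] R1 n by (intro divide_right_mono) auto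
  also have "\<dots> = (R powr (1 - \<rho>) / (4 * n)) ^ (2 * M)"
    using R1 by (simp add: power_divide powr_powr powr_realpow[symmetric] mult_ac)
  also have "R powr (1 - \<rho>) / (4 * n) = R / (4 * n) / R powr \<rho>"
    using R1 by (simp add: powr_diff)
  also have "(R / (4 * n) / R powr \<rho>) ^ (2 * M) \<le> (\<bar>real_of_int (l $ j - c $ j)\<bar> / L) ^ (2 * M)"
    using R1 n L1 LR j by (intro power_mono frac_le) auto
  also have "\<dots> = (real_of_int (l $ j - c $ j) / L) ^ (2 * M)"
    by (simp add: power_divide power_even_abs)
  also have "\<dots> \<le> (\<Sum>j\<in>UNIV. (real_of_int (l $ j - c $ j) / L) ^ (2 * M))"
    by (rule member_le_sum[of j UNIV "\<lambda>j. (real_of_int (l $ j - c $ j) / L) ^ (2 * M)"])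
       (auto simp: power_mult)
  also have "\<dots> \<le> box_weight \<rho> M i l"
    by (simp add: box_weight_def c_def L_def s_def)
  finally have "R / (4 * n) ^ (2 * M) \<le> box_weight \<rho> M i l" .
  then show ?thesis
    using R1 n box_weight_ge_1[of \<rho> M i l] by (simp add: R_def n_def s_def divide_simps mult_ac)
qed

text \<open>
  In units of the side length, the weights of the boxes of one level are translates of each other
  along the integer lattice; this product majorant has a bounded sum over \<open>snd i\<close>.
\<close>

lemma box_weight_near:
  fixes i :: "nat \<times> (int ^ 'n::finite)"
  assumes \<rho>: "0 \<le> \<rho>" "\<rho> < 1" and M: "CARD('n) \<le> M"
  shows "1 / box_weight \<rho> M i l
    \<le> 2 ^ M * (\<Prod>j\<in>UNIV. 1 / (1 + (l $ j / box_side \<rho> CARD('n) (fst i) - snd i $ j)\<^sup>2))"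
proof -
  define L where "L = real (box_side \<rho> CARD('n) (fst i))"
  have L1: "1 \<le> L" using box_side_ge_1[of \<rho> "CARD('n)"] \<rho> by (simp add: L_def)
  define y :: "real ^ 'n" where "y = (\<chi> j. l $ j / L - snd i $ j)"
  have "box_weight \<rho> M i l = 1 + (\<Sum>j\<in>UNIV. (y $ j) ^ (2 * M))"
    using L1 by (simp add: box_weight_def y_def box_corner_def L_def[symmetric] field_simps)
  then have "(\<Prod>j\<in>UNIV. 1 + (y $ j)\<^sup>2) \<le> 2 ^ M * box_weight \<rho> M i l"
    using prod_one_plus_square_le[OF M, of y] by simp
  moreover have "0 < (\<Prod>j\<in>UNIV. 1 + (y $ j)\<^sup>2)" by (intro prod_pos) (simp add: add_pos_nonneg)
  ultimately have "1 / box_weight \<rho> M i l \<le> 2 ^ M * (1 / (\<Prod>j\<in>UNIV. 1 + (y $ j)\<^sup>2))"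
    using box_weight_ge_1[of \<rho> M i l] by (simp add: divide_simps mult_ac)
  then show ?thesis by (simp add: prod_dividef y_def L_def)
qed

text \<open>
  At most three powers of two lie between \<open>x / 4\<close> and \<open>2 * x\<close>.
\<close>

lemma sum_level_weights:
  fixes x D :: real and S :: "nat set"
  assumes "finite S" and D: "0 \<le> D"
  shows "(\<Sum>s\<in>S. if 2 ^ s < 2 * x \<and> x < 4 * 2 ^ s then 1 else D / 2 ^ s) \<le> 3 + 2 * D"
proof -
  let ?N = "{s\<in>S. 2 ^ s < 2 * x \<and> x < 4 * 2 ^ s}"
  have "card ?N \<le> 3"
  proof (cases "?N = {}")
    case False
    define m where "m = Min ?N"
    have m: "m \<in> ?N" unfolding m_def by (rule Min_in) (use assms False in simp_all)
    have "?N \<subseteq> {m..<m + 3}"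
    proof
      fix s assume s: "s \<in> ?N"
      have "m \<le> s" using s assms unfolding m_def by simp
      moreover have "(2 :: real) ^ s < 2 ^ (m + 3)" using s m by (simp add: power_add)
      then have "s < m + 3" by (rule power_less_imp_less_exp[rotated]) simp
      ultimately show "s \<in> {m..<m + 3}" by simp
    qed
    then show ?thesis using card_mono[of "{m..<m + 3}" ?N] by simp
  next
    case True
    then show ?thesis by (simp only: card.empty)
  qed
  then have near: "(\<Sum>s\<in>S. if 2 ^ s < 2 * x \<and> x < 4 * 2 ^ s then 1 else 0) \<le> (3 :: real)"
    using assms by (simp add: sum.If_cases Int_def)
  have summ: "summable (\<lambda>s. (1 / 2 :: real) ^ s)" by (rule summable_geometric) simp
  have geom: "(\<Sum>s\<in>S. (1 / 2 :: real) ^ s) \<le> 2"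
    using sum_le_suminf[OF summ, of S] assms suminf_geometric[of "1 / 2 :: real"] by simp
  have "(\<Sum>s\<in>S. D / 2 ^ s) = D * (\<Sum>s\<in>S. (1 / 2 :: real) ^ s)"
    by (simp add: sum_distrib_left power_divide)
  also have "\<dots> \<le> D * 2" using geom D by (rule mult_left_mono)
  finally have far: "(\<Sum>s\<in>S. D / 2 ^ s) \<le> 2 * D" by simp
  have "(\<Sum>s\<in>S. if 2 ^ s < 2 * x \<and> x < 4 * 2 ^ s then 1 else D / 2 ^ s)
      \<le> (\<Sum>s\<in>S. (if 2 ^ s < 2 * x \<and> x < 4 * 2 ^ s then 1 else 0) + D / 2 ^ s)"
    using D by (intro sum_mono) auto
  then show ?thesis using near far by (simp add: sum.distrib)
qed

text \<open>
  One of the two factors \<open>1 / box_weight\<close> is spent on the sum over the boxes of a level, the other one on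
  the sum over the levels.
\<close>

lemma box_weight_sum_bounded:
  assumes \<rho>: "0 \<le> \<rho>" "\<rho> < 1" and M: "CARD('n::finite) \<le> M" "1 \<le> 2 * real M * (1 - \<rho>)"
  shows "\<exists>C\<ge>0. \<forall>K (l :: int ^ 'n). finite K \<longrightarrow> (\<Sum>i\<in>box_index \<rho> ` K. 1 / (box_weight \<rho> M i l)\<^sup>2) \<le> C"
proof -
  obtain C0 where C0: "0 \<le> C0" and sumC0: "\<And>F (y :: real ^ 'n). finite F \<Longrightarrow>
      (\<Sum>q\<in>F. \<Prod>j\<in>UNIV. 1 / (1 + (y $ j - real_of_int (q $ j))\<^sup>2)) \<le> C0"
    using lattice_sum_bounded by blast
  define D where "D = (4 * real CARD('n)) ^ (2 * M)"
  have D: "0 \<le> D" by (simp add: D_def)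
  have "(\<Sum>i\<in>box_index \<rho> ` K. 1 / (box_weight \<rho> M i l)\<^sup>2) \<le> (3 + 2 * D) * (2 ^ M * C0)"
    if K: "finite K" for K and l :: "int ^ 'n"
  proof -
    define x where "x = 1 + norm (lattice_vec l)"
    define w where "w s = (if 2 ^ s < 2 * x \<and> x < 4 * 2 ^ s then 1 else D / 2 ^ s)" for s :: nat
    define p where "p s q = 2 ^ M * (\<Prod>j\<in>UNIV. 1 / (1 + (l $ j / box_side \<rho> CARD('n) s - q $ j)\<^sup>2))"
      for s and q :: "int ^ 'n"
    let ?I = "box_index \<rho> ` K"
    have w0: "0 \<le> w s" for s using D by (simp add: w_def)
    have p0: "0 \<le> p s q" for s q unfolding p_def by (intro mult_nonneg_nonneg prod_nonneg) auto
    have term_le: "1 / (box_weight \<rho> M i l)\<^sup>2 \<le> w (fst i) * p (fst i) (snd i)" if "i \<in> ?I" for i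
    proof -
      have "1 / box_weight \<rho> M i l \<le> 1" using box_weight_ge_1[of \<rho> M i l] by simp
      moreover obtain k where "box_index \<rho> k = i" using \<open>i \<in> ?I\<close> by auto
      ultimately have "1 / box_weight \<rho> M i l \<le> w (fst i)"
        using box_weight_far[OF \<rho> M(2), of k i l] by (auto simp: w_def D_def x_def)
      then have "1 / box_weight \<rho> M i l * (1 / box_weight \<rho> M i l) \<le> w (fst i) * p (fst i) (snd i)"
        using box_weight_near[OF \<rho> M(1), of i l] box_weight_ge_1[of \<rho> M i l] w0
        by (intro mult_mono) (auto simp: p_def)
      then show ?thesis by (simp add: power2_eq_square)
    qed
    have "(\<Sum>i\<in>?I. 1 / (box_weight \<rho> M i l)\<^sup>2) \<le> (\<Sum>i\<in>?I. w (fst i) * p (fst i) (snd i))"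
      by (intro sum_mono term_le)
    also have "\<dots> \<le> (\<Sum>i\<in>fst ` ?I \<times> snd ` ?I. w (fst i) * p (fst i) (snd i))"
      using K by (intro sum_mono2 subset_fst_snd mult_nonneg_nonneg w0 p0) simp
    also have "\<dots> = (\<Sum>s\<in>fst ` ?I. \<Sum>q\<in>snd ` ?I. w s * p s q)"
      by (simp add: sum.cartesian_product case_prod_beta)
    also have "\<dots> = (\<Sum>s\<in>fst ` ?I. w s * (\<Sum>q\<in>snd ` ?I. p s q))"
      by (simp add: sum_distrib_left)
    also have "\<dots> \<le> (\<Sum>s\<in>fst ` ?I. w s * (2 ^ M * C0))"
    proof (intro sum_mono mult_left_mono w0)
      fix s
      show "(\<Sum>q\<in>snd ` ?I. p s q) \<le> 2 ^ M * C0"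
        using sumC0[of "snd ` ?I" "\<chi> j. l $ j / box_side \<rho> CARD('n) s"] K
        unfolding p_def by (simp add: sum_distrib_left[symmetric])
    qed
    also have "\<dots> \<le> (3 + 2 * D) * (2 ^ M * C0)"
      using sum_level_weights[OF _ D, of "fst ` ?I" x] K C0
      by (simp add: sum_distrib_right[symmetric] w_def mult_right_mono)
    finally show ?thesis .
  qed
  then show ?thesis using C0 D by (intro exI[of _ "(3 + 2 * D) * (2 ^ M * C0)"]) auto
qed

section \<open>Estimate on one box\<close>

text \<open>
  The symbol estimates in terms of the side of a box, with one constant for the finitely many
  differences and derivatives in use.
\<close>

lemma symbol_bound_on_boxes:
  fixes m :: "int ^ 'n::finite \<Rightarrow> real ^ 'n \<Rightarrow> complex"
  assumes \<rho>: "0 \<le> \<rho>" "\<rho> < 1"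
    and symbol: "\<And>\<alpha> \<beta> :: nat ^ 'n. \<exists>C. \<forall>k \<xi>.
      cmod (mi_power partial_deriv \<beta> (\<lambda>\<eta>. mi_power partial_diff \<alpha> (\<lambda>l. m l \<eta>) k) \<xi>)
        \<le> C * (1 + norm (lattice_vec k)) powr ((real (mi_order \<beta>) - real (mi_order \<alpha>)) * \<rho>)"
  shows "\<exists>A\<ge>0. \<forall>k k' S j b \<xi>. k' \<in> box_of \<rho> (box_index \<rho> k) \<longrightarrow> b \<le> N \<longrightarrow>
    cmod ((partial_deriv j ^^ b) (\<lambda>\<eta>. foldr partial_diff (filter (\<lambda>i. i \<in> S) coords) (\<lambda>l. m l \<eta>) k') \<xi>)
      \<le> A * real (box_side \<rho> CARD('n) (dyadic_level k)) ^ b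
          / real (box_side \<rho> CARD('n) (dyadic_level k)) ^ card S"
proof -
  define est where "est S j b C \<longleftrightarrow> (\<forall>k \<xi>. cmod ((partial_deriv j ^^ b)
      (\<lambda>\<eta>. foldr partial_diff (filter (\<lambda>i. i \<in> S) coords) (\<lambda>l. m l \<eta>) k) \<xi>)
        \<le> C * (1 + norm (lattice_vec k)) powr ((real b - real (card S)) * \<rho>))" for S j b C
  have "\<exists>C. est S j b C" for S j b
    using symbol[of "\<chi> i. if i = j then b else 0" "\<chi> i. if i \<in> S then 1 else 0"]
    unfolding est_def mi_power_single mi_power_indicator mi_order_single mi_order_indicator .
  then obtain C where "est S j b (C S j b)" for S j b by metis
  then have C: "cmod ((partial_deriv j ^^ b)
      (\<lambda>\<eta>. foldr partial_diff (filter (\<lambda>i. i \<in> S) coords) (\<lambda>l. m l \<eta>) k) \<xi>)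
        \<le> C S j b * (1 + norm (lattice_vec k)) powr ((real b - real (card S)) * \<rho>)" for S j b k \<xi>
    by (simp add: est_def)
  define C' where "C' = (\<Sum>(S, j, b)\<in>UNIV \<times> UNIV \<times> {..N}. \<bar>C S j b\<bar>)"
  define \<kappa> where "\<kappa> = 18 * real CARD('n)"
  have \<kappa>: "1 \<le> \<kappa>" using zero_less_card_finite[where 'a='n] unfolding \<kappa>_def by linarith
  have C': "0 \<le> C'" unfolding C'_def by (intro sum_nonneg) auto
  have C_le: "C S j b \<le> C'" if "b \<le> N" for S j b
  proof -
    have "(\<lambda>(S, j, b). \<bar>C S j b\<bar>) (S, j, b) \<le> C'"
      unfolding C'_def using that by (intro member_le_sum) auto
    then show ?thesis by simp
  qed
  have "cmod ((partial_deriv j ^^ b) (\<lambda>\<eta>. foldr partial_diff (filter (\<lambda>i. i \<in> S) coords) (\<lambda>l. m l \<eta>) k') \<xi>)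
      \<le> C' * \<kappa> ^ (N + CARD('n)) * L ^ b / L ^ card S"
    if k': "k' \<in> box_of \<rho> (box_index \<rho> k)" and b: "b \<le> N"
      and L_def: "L = real (box_side \<rho> CARD('n) (dyadic_level k))" for k k' S j b \<xi> L
  proof -
    define W where "W = (1 + norm (lattice_vec k')) powr \<rho>"
    have L1: "1 \<le> L" using box_side_ge_1[of \<rho> "CARD('n)"] \<rho> by (simp add: L_def)
    have W: "L / \<kappa> \<le> W" "W \<le> \<kappa> * L"
      using box_side_comparable[OF \<rho>(1) _ k'] \<rho> by (auto simp: L_def W_def \<kappa>_def)
    have "0 < 1 + norm (lattice_vec k')" by (simp add: add_pos_nonneg)
    then have W0: "0 < W" unfolding W_def by simp
    have "(1 + norm (lattice_vec k')) powr ((real b - real (card S)) * \<rho>) = W powr (real b - real (card S))"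
      unfolding W_def powr_powr by (simp only: mult.commute)
    also have "\<dots> = W ^ b / W ^ card S" using W0 by (simp add: powr_diff powr_realpow)
    also have "\<dots> \<le> (\<kappa> * L) ^ b / (L / \<kappa>) ^ card S"
      using W W0 L1 \<kappa> by (intro frac_le power_mono) auto
    also have "\<dots> = \<kappa> ^ (b + card S) * (L ^ b / L ^ card S)"
      by (simp add: power_divide power_mult_distrib power_add)
    also have "\<dots> \<le> \<kappa> ^ (N + CARD('n)) * (L ^ b / L ^ card S)"
      using \<kappa> b L1 by (intro mult_right_mono power_increasing add_mono card_mono) auto
    finally have "C S j b * (1 + norm (lattice_vec k')) powr ((real b - real (card S)) * \<rho>)
        \<le> C' * (\<kappa> ^ (N + CARD('n)) * (L ^ b / L ^ card S))"
      using C_le[OF b] C' by (intro mult_mono) auto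
    with C[where j = j and b = b and S = S and k = k' and \<xi> = \<xi>] show ?thesis by simp
  qed
  then show ?thesis
    using C' \<kappa> by (intro exI[of _ "C' * \<kappa> ^ (N + CARD('n))"]) auto
qed

text \<open>
  The operator is applied to \<open>P * g\<close>, and \<open>P\<close> is moved into the symbol. Each power of
  \<open>l $ j - x $ j\<close> is absorbed by the kernel at the price of one derivative of the symbol, of size \<open>L\<close>,
  which the normalisation of \<open>P\<close> compensates. Each power of \<open>x $ j - c $ j\<close> is at most the same power of
  \<open>L\<close>, as \<open>x\<close> lies in the box. What remains is a sum of pseudo-differential operators applied to \<open>g\<close>,
  each one bounded by \<open>discrete_sobolev\<close>.
\<close>

lemma box_estimate:
  fixes m :: "int ^ 'n::finite \<Rightarrow> real ^ 'n \<Rightarrow> complex" and g :: "int ^ 'n \<Rightarrow> complex"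
  assumes smooth: "\<And>k. smooth_torus (m k)" and A: "0 \<le> A" and L: "1 \<le> L"
    and symbol: "\<And>k S j b \<xi>. k \<in> lattice_box c L \<Longrightarrow> b \<le> 2 * M \<Longrightarrow>
      cmod ((partial_deriv j ^^ b) (\<lambda>\<eta>. foldr partial_diff (filter (\<lambda>i. i \<in> S) coords) (\<lambda>l. m l \<eta>) k) \<xi>)
        \<le> A * real L ^ b / real L ^ card S"
    and fin: "finite X" "finite F" and X: "X \<subseteq> lattice_box c L"
  defines "P \<equiv> \<lambda>l. 1 + (\<Sum>j\<in>UNIV. (real_of_int (l $ j - c $ j) / real L) ^ (2 * M))"
  shows "L2_set (\<lambda>k. cmod (\<Sum>l\<in>F. fourier_coeff (m k) (k - l) * (P l * g l))) X
    \<le> 2 ^ CARD('n) * A * (1 + real CARD('n) * 2 ^ (2 * M)) * L2_set (\<lambda>l. cmod (g l)) F"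
proof -
  define G where "G = L2_set (\<lambda>l. cmod (g l)) F"
  define T where "T j b k x = fourier_coeff (\<lambda>\<xi>. (partial_deriv j ^^ b) (m k) \<xi> * trig_poly g F \<xi>) x" for j b k x
  \<comment> \<open>\<open>\<Phi> j b x u\<close> is the value at \<open>x\<close> of the multiplier with symbol \<open>(partial_deriv j ^^ b) u\<close> applied to the restriction of \<open>g\<close> to \<open>F\<close>; \<open>T\<close> is its value for the family \<open>m\<close>.\<close>
  define \<Phi> where "\<Phi> j b x u = fourier_coeff (\<lambda>\<xi>. (partial_deriv j ^^ b) u \<xi> * trig_poly g F \<xi>) x" for j b x u
  have sm: "smooth (m k)" for k using smooth by (simp add: smooth_torus_def)
  have cont: "continuous_on B ((partial_deriv j ^^ b) u)" if "smooth u" for u j b B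
    using smooth_continuous[OF that, of B "replicate b j"] by (simp add: foldr_replicate)
  have T_sum: "T j b k x = (\<Sum>l\<in>F. fourier_coeff ((partial_deriv j ^^ b) (m k)) (x - l) * g l)" for j b k x
    unfolding T_def by (intro fourier_coeff_times_trig_poly cont sm)
  have \<Phi>_diff: "\<Phi> j b x (\<lambda>\<xi>. u \<xi> - v \<xi>) = \<Phi> j b x u - \<Phi> j b x v" if "smooth u" "smooth v" for j b x u v
  proof -
    have D: "(partial_deriv j ^^ b) (\<lambda>\<xi>. u \<xi> - v \<xi>) = (\<lambda>\<xi>. (partial_deriv j ^^ b) u \<xi> - (partial_deriv j ^^ b) v \<xi>)"
      using foldr_partial_deriv_diff[OF that, of "replicate b j"] by (simp add: foldr_replicate)
    have "\<Phi> j b x (\<lambda>\<xi>. u \<xi> - v \<xi>) = integral (cbox 0 1) (\<lambda>\<xi>.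
        torus_char x \<xi> * ((partial_deriv j ^^ b) u \<xi> * trig_poly g F \<xi>)
        - torus_char x \<xi> * ((partial_deriv j ^^ b) v \<xi> * trig_poly g F \<xi>))"
      unfolding \<Phi>_def fourier_coeff_def D by (simp only: left_diff_distrib right_diff_distrib)
    also have "\<dots> = \<Phi> j b x u - \<Phi> j b x v"
      unfolding \<Phi>_def fourier_coeff_def
      by (intro integral_diff integrable_continuous continuous_intros continuous_on_torus_char
            continuous_on_trig_poly cont that)
    finally show ?thesis .
  qed
  have T_bound: "L2_set (\<lambda>x. cmod (T j b x x)) X \<le> 2 ^ CARD('n) * (A * real L ^ b * G)" if b: "b \<le> 2 * M" for j b
  proof (rule discrete_sobolev[where F = "T j b", OF L X])
    fix S :: "'n set" and k :: "int ^ 'n" assume k: "k \<in> lattice_box c L"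
    let ?u = "\<lambda>\<eta>. foldr partial_diff (filter (\<lambda>i. i \<in> S) coords) (\<lambda>l. m l \<eta>) k"
    have functional: "smooth ?u \<and> \<Phi> j b x ?u = foldr partial_diff (filter (\<lambda>i. i \<in> S) coords) (\<lambda>l. \<Phi> j b x (m l)) k" for x
      by (rule foldr_partial_diff_functional[where P = smooth and \<Phi> = "\<Phi> j b x", OF \<Phi>_diff smooth_diff sm])
    then have u: "smooth ?u" by blast
    have eq: "foldr partial_diff (filter (\<lambda>i. i \<in> S) coords) (\<lambda>l. T j b l x) k = \<Phi> j b x ?u" for x
      using functional[of x] unfolding T_def \<Phi>_def by (elim conjE) (rule sym)
    have "L2_set (\<lambda>x. cmod (\<Phi> j b x ?u)) X \<le> A * real L ^ b / real L ^ card S * G"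
      unfolding \<Phi>_def G_def
      by (rule fourier_multiplier_bound[OF cont[OF u] symbol[OF k b] fin])
    then show "L2_set (\<lambda>x. cmod (foldr partial_diff (filter (\<lambda>i. i \<in> S) coords) (\<lambda>l. T j b l x) k)) X
        \<le> A * real L ^ b * G / real L ^ card S"
      unfolding eq by simp
  qed
  have moment: "fourier_coeff (m x) (x - l) * of_int (l $ j - x $ j) ^ b
      = fourier_coeff ((partial_deriv j ^^ b) (m x)) (x - l) / (2 * pi * \<i>) ^ b" for x l j b
  proof -
    have "fourier_coeff ((partial_deriv j ^^ b) (m x)) (x - l)
        = (2 * pi * \<i> * of_int (l $ j - x $ j)) ^ b * fourier_coeff (m x) (x - l)"
      using fourier_coeff_partial_deriv_power(2)[OF smooth, where j = j and b = b and k = "x - l"] by (simp add: algebra_simps)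
    then show ?thesis by (simp add: power_mult_distrib)
  qed
  define a where "a x j b = of_nat (2 * M choose b) * (of_int (x $ j - c $ j) / of_nat L) ^ (2 * M - b)
      / (2 * pi * \<i> * of_nat L) ^ b" for x :: "int ^ 'n" and j and b :: nat
  have expand_weight: "(\<Sum>l\<in>F. fourier_coeff (m x) (x - l) *
        (of_real ((real_of_int (l $ j - c $ j) / real L) ^ (2 * M)) * g l)) = (\<Sum>b\<le>2 * M. a x j b * T j b x x)" for x j
  proof -
    have "fourier_coeff (m x) (x - l) * (of_real ((real_of_int (l $ j - c $ j) / real L) ^ (2 * M)) * g l)
        = (\<Sum>b\<le>2 * M. a x j b * (fourier_coeff ((partial_deriv j ^^ b) (m x)) (x - l) * g l))" for l
    proof -
      have "complex_of_real ((real_of_int (l $ j - c $ j) / real L) ^ (2 * M))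
          = (of_int (l $ j - x $ j) / of_nat L + of_int (x $ j - c $ j) / of_nat L) ^ (2 * M)"
        by (simp add: add_divide_distrib[symmetric])
      also have "\<dots> = (\<Sum>b\<le>2 * M. of_nat (2 * M choose b) * (of_int (l $ j - x $ j) / of_nat L) ^ b
          * (of_int (x $ j - c $ j) / of_nat L) ^ (2 * M - b))"
        by (rule binomial_ring)
      finally have "fourier_coeff (m x) (x - l) * (of_real ((real_of_int (l $ j - c $ j) / real L) ^ (2 * M)) * g l)
          = (\<Sum>b\<le>2 * M. of_nat (2 * M choose b) * (of_int (x $ j - c $ j) / of_nat L) ^ (2 * M - b) / of_nat L ^ b
             * (fourier_coeff (m x) (x - l) * of_int (l $ j - x $ j) ^ b) * g l)"
        by (simp add: sum_distrib_left sum_distrib_right power_divide mult_ac)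
      also have "\<dots> = (\<Sum>b\<le>2 * M. a x j b * (fourier_coeff ((partial_deriv j ^^ b) (m x)) (x - l) * g l))"
        unfolding moment a_def by (intro sum.cong refl) (simp add: power_mult_distrib field_simps)
      finally show ?thesis .
    qed
    then have "(\<Sum>l\<in>F. fourier_coeff (m x) (x - l) * (of_real ((real_of_int (l $ j - c $ j) / real L) ^ (2 * M)) * g l))
        = (\<Sum>l\<in>F. \<Sum>b\<le>2 * M. a x j b * (fourier_coeff ((partial_deriv j ^^ b) (m x)) (x - l) * g l))"
      by simp
    also have "\<dots> = (\<Sum>b\<le>2 * M. \<Sum>l\<in>F. a x j b * (fourier_coeff ((partial_deriv j ^^ b) (m x)) (x - l) * g l))"
      by (rule sum.swap)
    finally show ?thesis by (simp add: T_sum sum_distrib_left)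
  qed
  \<comment> \<open>The constant term of \<open>P\<close> corresponds to no derivative at all, which is written as order \<open>0\<close> in an arbitrary direction.\<close>
  obtain j0 :: 'n where True by simp
  have a_bound: "cmod (a x j b) \<le> real (2 * M choose b) / real L ^ b" if "x \<in> X" for x j b
  proof -
    have "0 \<le> x $ j - c $ j" "x $ j - c $ j \<le> int L"
      using that X by (auto simp: lattice_box_def dest!: subsetD spec[of _ j])
    then have "\<bar>real_of_int (x $ j - c $ j)\<bar> \<le> real L" by linarith
    then have "\<bar>real_of_int (x $ j - c $ j)\<bar> / real L \<le> 1" using L by simp
    then have 1: "(\<bar>real_of_int (x $ j - c $ j)\<bar> / real L) ^ (2 * M - b) \<le> 1" by (intro power_le_one) auto
    have "1 * real L \<le> 2 * pi * real L" using pi_ge_two by (intro mult_right_mono) auto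
    then have 2: "real L ^ b \<le> (2 * pi * real L) ^ b" by (intro power_mono) auto
    have pi2: "\<bar>2 * pi\<bar> = 2 * pi" by simp
    have "cmod (a x j b) = real (2 * M choose b) * (\<bar>real_of_int (x $ j - c $ j)\<bar> / real L) ^ (2 * M - b)
        / (2 * pi * real L) ^ b"
      unfolding a_def by (simp only: norm_mult norm_divide norm_power norm_of_nat norm_of_int norm_of_real
          norm_ii norm_numeral pi2 mult_1_right of_int_abs)
    also have "\<dots> \<le> real (2 * M choose b) * 1 / real L ^ b"
      using 1 2 L by (intro frac_le mult_left_mono mult_nonneg_nonneg) auto
    finally show ?thesis by simp
  qed
  have pointwise: "cmod (\<Sum>l\<in>F. fourier_coeff (m x) (x - l) * (P l * g l))
      \<le> cmod (T j0 0 x x) + (\<Sum>j\<in>UNIV. \<Sum>b\<le>2 * M. real (2 * M choose b) / real L ^ b * cmod (T j b x x))"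
    if x: "x \<in> X" for x
  proof -
    have "(\<Sum>l\<in>F. fourier_coeff (m x) (x - l) * (P l * g l)) = (\<Sum>l\<in>F. fourier_coeff (m x) (x - l) * g l
        + (\<Sum>j\<in>UNIV. fourier_coeff (m x) (x - l) * (of_real ((real_of_int (l $ j - c $ j) / real L) ^ (2 * M)) * g l)))"
      unfolding P_def of_real_add of_real_sum of_real_1
      by (intro sum.cong refl) (simp only: distrib_left distrib_right mult_1_left sum_distrib_left sum_distrib_right)
    also have "\<dots> = T j0 0 x x + (\<Sum>j\<in>UNIV. \<Sum>l\<in>F. fourier_coeff (m x) (x - l) *
        (of_real ((real_of_int (l $ j - c $ j) / real L) ^ (2 * M)) * g l))"
      by (subst sum.swap) (simp add: sum.distrib T_sum)
    also have "cmod \<dots> \<le> cmod (T j0 0 x x) + (\<Sum>j\<in>UNIV. \<Sum>b\<le>2 * M. cmod (a x j b) * cmod (T j b x x))"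
      unfolding expand_weight norm_mult[symmetric]
      by (intro order_trans[OF norm_triangle_ineq] add_left_mono order_trans[OF norm_sum] sum_mono norm_sum)
    also have "\<dots> \<le> cmod (T j0 0 x x) + (\<Sum>j\<in>UNIV. \<Sum>b\<le>2 * M. real (2 * M choose b) / real L ^ b * cmod (T j b x x))"
      by (intro add_left_mono sum_mono mult_right_mono a_bound x) auto
    finally show ?thesis .
  qed
  have "L2_set (\<lambda>k. cmod (\<Sum>l\<in>F. fourier_coeff (m k) (k - l) * (P l * g l))) X
      \<le> L2_set (\<lambda>x. cmod (T j0 0 x x)
          + (\<Sum>j\<in>UNIV. \<Sum>b\<le>2 * M. real (2 * M choose b) / real L ^ b * cmod (T j b x x))) X"
    by (intro L2_set_mono pointwise) auto
  also have "\<dots> \<le> L2_set (\<lambda>x. cmod (T j0 0 x x)) X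
      + (\<Sum>j\<in>UNIV. \<Sum>b\<le>2 * M. L2_set (\<lambda>x. real (2 * M choose b) / real L ^ b * cmod (T j b x x)) X)"
    by (intro order_trans[OF L2_set_triangle_ineq] add_left_mono order_trans[OF L2_set_sum_le] sum_mono L2_set_sum_le) auto
  also have "\<dots> = L2_set (\<lambda>x. cmod (T j0 0 x x)) X
      + (\<Sum>j\<in>UNIV. \<Sum>b\<le>2 * M. real (2 * M choose b) / real L ^ b * L2_set (\<lambda>x. cmod (T j b x x)) X)"
    by (subst L2_set_right_distrib) auto
  also have "\<dots> \<le> 2 ^ CARD('n) * (A * real L ^ 0 * G)
      + (\<Sum>j\<in>(UNIV :: 'n set). \<Sum>b\<le>2 * M. real (2 * M choose b) / real L ^ b * (2 ^ CARD('n) * (A * real L ^ b * G)))"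
    by (intro add_mono sum_mono mult_left_mono T_bound) auto
  also have "\<dots> = 2 ^ CARD('n) * (A * G) + (\<Sum>j\<in>(UNIV :: 'n set). \<Sum>b\<le>2 * M. real (2 * M choose b) * (2 ^ CARD('n) * (A * G)))"
    using L by simp
  also have "\<dots> = 2 ^ CARD('n) * (A * G) + real CARD('n) * (2 ^ (2 * M) * (2 ^ CARD('n) * (A * G)))"
    using choose_row_sum[of "2 * M"] by (simp add: sum_distrib_right[symmetric] of_nat_sum[symmetric] del: of_nat_sum)
  finally show ?thesis by (simp add: G_def algebra_simps)
qed

section \<open>Bound for finite sections and extension to all square-summable functions\<close>

text \<open>
  Apply the estimate on each box to \<open>f / box_weight\<close>, sum over the boxes, and interchange the sums.
\<close>

lemma finite_section_bound:
  fixes m :: "int ^ 'n::finite \<Rightarrow> real ^ 'n \<Rightarrow> complex"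
  assumes \<rho>: "0 \<le> \<rho>" "\<rho> < 1" and smooth: "\<And>k. smooth_torus (m k)"
    and symbol: "\<And>\<alpha> \<beta> :: nat ^ 'n. \<exists>C. \<forall>k \<xi>.
      cmod (mi_power partial_deriv \<beta> (\<lambda>\<eta>. mi_power partial_diff \<alpha> (\<lambda>l. m l \<eta>) k) \<xi>)
        \<le> C * (1 + norm (lattice_vec k)) powr ((real (mi_order \<beta>) - real (mi_order \<alpha>)) * \<rho>)"
  shows "\<exists>B\<ge>0. \<forall>K F f. finite K \<longrightarrow> finite F \<longrightarrow>
    (\<Sum>k\<in>K. (cmod (\<Sum>l\<in>F. fourier_coeff (m k) (k - l) * f l))\<^sup>2) \<le> B * (\<Sum>l\<in>F. (cmod (f l))\<^sup>2)"
proof -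
  \<comment> \<open>The first summand makes the lattice sums over one level converge, the second one the sum over the levels.\<close>
  define M where "M = CARD('n) + nat \<lceil>1 / (1 - \<rho>)\<rceil>"
  have M1: "CARD('n) \<le> M" by (simp add: M_def)
  have "1 / (1 - \<rho>) \<le> real M" unfolding M_def by linarith
  then have "1 \<le> real M * (1 - \<rho>)" using \<rho> by (simp add: divide_simps)
  then have M2: "1 \<le> 2 * real M * (1 - \<rho>)" by linarith
  obtain A where A: "0 \<le> A" and bound: "\<And>k k' S j b \<xi>. k' \<in> box_of \<rho> (box_index \<rho> k) \<Longrightarrow> b \<le> 2 * M \<Longrightarrow>
    cmod ((partial_deriv j ^^ b) (\<lambda>\<eta>. foldr partial_diff (filter (\<lambda>i. i \<in> S) coords) (\<lambda>l. m l \<eta>) k') \<xi>)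
      \<le> A * real (box_side \<rho> CARD('n) (dyadic_level k)) ^ b
          / real (box_side \<rho> CARD('n) (dyadic_level k)) ^ card S"
    using symbol_bound_on_boxes[OF \<rho> symbol, of "2 * M"] by blast
  obtain C where C: "0 \<le> C" and sumC: "\<And>K (l :: int ^ 'n). finite K \<Longrightarrow>
      (\<Sum>i\<in>box_index \<rho> ` K. 1 / (box_weight \<rho> M i l)\<^sup>2) \<le> C"
    using box_weight_sum_bounded[OF \<rho> M1 M2] by blast
  define B where "B = 2 ^ CARD('n) * A * (1 + real CARD('n) * 2 ^ (2 * M))"
  have B: "0 \<le> B" using A by (simp add: B_def)
  have "(\<Sum>k\<in>K. (cmod (\<Sum>l\<in>F. fourier_coeff (m k) (k - l) * f l))\<^sup>2) \<le> (B\<^sup>2 * C) * (\<Sum>l\<in>F. (cmod (f l))\<^sup>2)"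
    if fin: "finite K" "finite F" for K F and f :: "int ^ 'n \<Rightarrow> complex"
  proof -
    let ?I = "box_index \<rho> ` K"
    have box: "(\<Sum>k\<in>{k\<in>K. box_index \<rho> k = i}. (cmod (\<Sum>l\<in>F. fourier_coeff (m k) (k - l) * f l))\<^sup>2)
        \<le> B\<^sup>2 * (\<Sum>l\<in>F. (cmod (f l))\<^sup>2 * (1 / (box_weight \<rho> M i l)\<^sup>2))" if i: "i \<in> ?I" for i
    proof -
      obtain k0 where k0: "i = box_index \<rho> k0" using i by auto
      then have fst_i: "fst i = dyadic_level k0" by (simp add: box_index_def)
      let ?X = "{k\<in>K. box_index \<rho> k = i}"
      let ?g = "\<lambda>l. f l / of_real (box_weight \<rho> M i l)"
      have X: "?X \<subseteq> lattice_box (box_corner \<rho> i) (box_side \<rho> CARD('n) (fst i))"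
        using box_of_index[of \<rho>] \<rho> unfolding box_of_def by fastforce
      have L2: "L2_set (\<lambda>k. cmod (\<Sum>l\<in>F. fourier_coeff (m k) (k - l) * (box_weight \<rho> M i l * ?g l))) ?X
          \<le> B * L2_set (\<lambda>l. cmod (?g l)) F"
        unfolding B_def box_weight_def
        by (rule box_estimate[OF smooth A _ _ _ fin(2) X])
           (use fin \<rho> bound[of _ k0] box_side_ge_1[of \<rho> "CARD('n)"] in \<open>auto simp: box_of_def k0[symmetric] fst_i[symmetric] Suc_le_eq\<close>)
      have w: "box_weight \<rho> M i l \<noteq> 0" for l using box_weight_ge_1[of \<rho> M i l] by auto
      have "(\<Sum>k\<in>?X. (cmod (\<Sum>l\<in>F. fourier_coeff (m k) (k - l) * f l))\<^sup>2)
          = (L2_set (\<lambda>k. cmod (\<Sum>l\<in>F. fourier_coeff (m k) (k - l) * (box_weight \<rho> M i l * ?g l))) ?X)\<^sup>2"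
        using w by (simp add: L2_set_def sum_nonneg)
      also have "\<dots> \<le> (B * L2_set (\<lambda>l. cmod (?g l)) F)\<^sup>2"
        using L2 by (intro power_mono) auto
      also have "\<dots> = B\<^sup>2 * (\<Sum>l\<in>F. (cmod (f l))\<^sup>2 * (1 / (box_weight \<rho> M i l)\<^sup>2))"
        by (simp add: L2_set_def sum_nonneg power_mult_distrib norm_divide power_divide)
      finally show ?thesis .
    qed
    have "(\<Sum>k\<in>K. (cmod (\<Sum>l\<in>F. fourier_coeff (m k) (k - l) * f l))\<^sup>2)
        = (\<Sum>i\<in>?I. \<Sum>k\<in>{k\<in>K. box_index \<rho> k = i}. (cmod (\<Sum>l\<in>F. fourier_coeff (m k) (k - l) * f l))\<^sup>2)"
      using fin by (intro sum.group[symmetric]) auto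
    also have "\<dots> \<le> (\<Sum>i\<in>?I. B\<^sup>2 * (\<Sum>l\<in>F. (cmod (f l))\<^sup>2 * (1 / (box_weight \<rho> M i l)\<^sup>2)))"
      by (intro sum_mono box)
    also have "\<dots> = B\<^sup>2 * (\<Sum>l\<in>F. (cmod (f l))\<^sup>2 * (\<Sum>i\<in>?I. 1 / (box_weight \<rho> M i l)\<^sup>2))"
      unfolding sum_distrib_left by (rule sum.swap)
    also have "\<dots> \<le> B\<^sup>2 * (\<Sum>l\<in>F. (cmod (f l))\<^sup>2 * C)"
      using fin by (intro mult_left_mono sum_mono sumC) auto
    also have "\<dots> = (B\<^sup>2 * C) * (\<Sum>l\<in>F. (cmod (f l))\<^sup>2)"
      by (simp add: sum_distrib_right[symmetric])
    finally show ?thesis .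
  qed
  then show ?thesis using C by (intro exI[of _ "B\<^sup>2 * C"]) auto
qed

lemma fourier_coeff_square_bounded:
  assumes "smooth_torus u" "finite X"
  shows "(\<Sum>l\<in>X. (cmod (fourier_coeff u l))\<^sup>2) \<le> integral (cbox 0 1) (\<lambda>\<xi>. (cmod (u \<xi>))\<^sup>2)"
  using assms smooth_continuous[of u UNIV "[]"] by (intro bessel_torus) (auto simp: smooth_torus_def)

text \<open>
  By Bessel's inequality each row of the matrix is square-summable.
\<close>

lemma kernel_times_l2_summable:
  assumes u: "smooth_torus u" and f: "f \<in> l2_lattice"
  shows "(\<lambda>l. fourier_coeff u (k - l) * f l) summable_on UNIV"
proof -
  let ?B = "integral (cbox 0 1) (\<lambda>\<xi>. (cmod (u \<xi>))\<^sup>2)"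
  let ?S = "\<Sum>\<^sub>\<infinity>l. (cmod (f l))\<^sup>2"
  have f': "(\<lambda>l. (cmod (f l))\<^sup>2) summable_on UNIV" using f by (simp add: l2_lattice_def)
  have "(\<lambda>l. norm (fourier_coeff u (k - l) * f l)) summable_on UNIV"
  proof (rule nonneg_bdd_above_summable_on)
    show "bdd_above (sum (\<lambda>l. norm (fourier_coeff u (k - l) * f l)) ` {F. F \<subseteq> UNIV \<and> finite F})"
    proof (rule bdd_aboveI2)
      fix F :: "(int ^ 'a) set" assume "F \<in> {F. F \<subseteq> UNIV \<and> finite F}"
      then have F: "finite F" by simp
      have "(\<Sum>l\<in>F. norm (fourier_coeff u (k - l) * f l))
          \<le> (\<Sum>l\<in>F. (cmod (fourier_coeff u (k - l)))\<^sup>2 + (cmod (f l))\<^sup>2)"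
      proof (intro sum_mono)
        fix l
        show "norm (fourier_coeff u (k - l) * f l) \<le> (cmod (fourier_coeff u (k - l)))\<^sup>2 + (cmod (f l))\<^sup>2"
          using sum_squares_bound[of "cmod (fourier_coeff u (k - l))" "cmod (f l)"]
            mult_nonneg_nonneg[OF norm_ge_zero norm_ge_zero, of "fourier_coeff u (k - l)" "f l"]
          unfolding norm_mult by linarith
      qed
      also have "\<dots> = (\<Sum>l\<in>(\<lambda>l. k - l) ` F. (cmod (fourier_coeff u l))\<^sup>2) + (\<Sum>l\<in>F. (cmod (f l))\<^sup>2)"
        by (simp add: sum.distrib sum.reindex inj_on_def)
      also have "\<dots> \<le> ?B + ?S"
        using F by (intro add_mono fourier_coeff_square_bounded u finite_sum_le_infsum f') auto
      finally show "(\<Sum>l\<in>F. norm (fourier_coeff u (k - l) * f l)) \<le> ?B + ?S" .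
    qed
  qed simp
  then show ?thesis by (rule abs_summable_summable)
qed

text \<open>
  Decay of order \<open>2 * n\<close> dominates the summable product of the \<open>1 / (1 + (l $ j)\<^sup>2)\<close>.
\<close>

lemma schwartz_lattice_abs_summable:
  fixes f :: "int ^ 'n::finite \<Rightarrow> complex"
  assumes "f \<in> schwartz_lattice"
  shows "(\<lambda>l. norm (f l)) summable_on UNIV"
proof -
  obtain C where C: "(1 + norm (lattice_vec l)) ^ (2 * CARD('n)) * cmod (f l) \<le> C" for l
    using assms unfolding schwartz_lattice_def by blast
  have C0: "0 \<le> C" using C[of 0] by (simp add: order_trans[OF norm_ge_zero])
  obtain C' where C': "\<And>F (y :: real ^ 'n). finite F \<Longrightarrow>
      (\<Sum>q\<in>F. \<Prod>j\<in>UNIV. 1 / (1 + (y $ j - real_of_int (q $ j))\<^sup>2)) \<le> C'"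
    using lattice_sum_bounded by blast
  have decay: "cmod (f l) \<le> C * (\<Prod>j\<in>UNIV. 1 / (1 + ((0 :: real ^ 'n) $ j - real_of_int (l $ j))\<^sup>2))" for l
  proof -
    let ?p = "\<Prod>j\<in>UNIV. 1 + (real_of_int (l $ j))\<^sup>2"
    have "?p \<le> (\<Prod>j\<in>(UNIV :: 'n set). (1 + norm (lattice_vec l))\<^sup>2)"
    proof (intro prod_mono conjI)
      fix j
      have "\<bar>real_of_int (l $ j)\<bar> \<le> norm (lattice_vec l)"
        using component_le_norm_cart[of "lattice_vec l" j] by simp
      then have "(real_of_int (l $ j))\<^sup>2 \<le> (norm (lattice_vec l))\<^sup>2"
        by (simp add: abs_le_square_iff[symmetric])
      moreover have "(1 + norm (lattice_vec l))\<^sup>2 = 1 + (norm (lattice_vec l))\<^sup>2 + 2 * norm (lattice_vec l)"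
        by (simp add: power2_sum)
      ultimately show "1 + (real_of_int (l $ j))\<^sup>2 \<le> (1 + norm (lattice_vec l))\<^sup>2"
        using norm_ge_zero[of "lattice_vec l"] by linarith
    qed (auto intro: add_nonneg_nonneg)
    then have "?p \<le> (1 + norm (lattice_vec l)) ^ (2 * CARD('n))" by (simp add: power_mult)
    then have "?p * cmod (f l) \<le> C"
      using C[of l] by (meson mult_right_mono norm_ge_zero order_trans)
    moreover have "0 < ?p" by (intro prod_pos) (simp add: add_pos_nonneg)
    ultimately have "cmod (f l) \<le> C * (1 / ?p)" by (simp add: divide_simps mult.commute)
    then show ?thesis by (simp add: prod_dividef)
  qed
  show ?thesis
  proof (rule nonneg_bdd_above_summable_on)
    show "bdd_above (sum (\<lambda>l. norm (f l)) ` {F. F \<subseteq> UNIV \<and> finite F})"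
    proof (rule bdd_aboveI2)
      fix F :: "(int ^ 'n) set" assume "F \<in> {F. F \<subseteq> UNIV \<and> finite F}"
      then have F: "finite F" by simp
      have "(\<Sum>l\<in>F. norm (f l)) \<le> C * (\<Sum>l\<in>F. \<Prod>j\<in>UNIV. 1 / (1 + ((0 :: real ^ 'n) $ j - real_of_int (l $ j))\<^sup>2))"
        unfolding sum_distrib_left by (intro sum_mono decay)
      also have "\<dots> \<le> C * C'" using C'[OF F, of 0] C0 by (rule mult_left_mono)
      finally show "(\<Sum>l\<in>F. norm (f l)) \<le> C * C'" .
    qed
  qed simp
qed

text \<open>
  The Fourier series of \<open>f\<close> converges uniformly, so that it may be integrated term by term.
\<close>

lemma pseudo_diff_op_eq_kernel_sum:
  fixes m :: "int ^ 'n::finite \<Rightarrow> real ^ 'n \<Rightarrow> complex"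
  assumes m: "smooth_torus (m k)" and f: "f \<in> schwartz_lattice"
  shows "pseudo_diff_op m f k = (\<Sum>\<^sub>\<infinity>l. fourier_coeff (m k) (k - l) * f l)"
proof -
  let ?h = "\<lambda>l \<xi>. torus_char k \<xi> * m k \<xi> * (cnj (torus_char l \<xi>) * f l)"
  let ?lim = "\<lambda>\<xi>. torus_char k \<xi> * m k \<xi> * discrete_fourier f \<xi>"
  have cont_m: "continuous_on A (m k)" for A
    using m smooth_continuous[of "m k" A "[]"] by (simp add: smooth_torus_def)
  have cont_h: "continuous_on A (?h l)" for A l
    by (intro continuous_intros continuous_on_torus_char cont_m)
  have abs_f: "(\<lambda>l. norm (f l)) summable_on UNIV" using f by (rule schwartz_lattice_abs_summable)
  have "bounded (m k ` cbox 0 1)"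
    by (intro compact_imp_bounded compact_continuous_image cont_m compact_cbox)
  then obtain B where B: "\<And>\<xi>. \<xi> \<in> cbox 0 1 \<Longrightarrow> cmod (m k \<xi>) \<le> B"
    unfolding bounded_iff by blast
  have "discrete_fourier f \<xi> = (\<Sum>\<^sub>\<infinity>l. cnj (torus_char l \<xi>) * f l)" for \<xi>
    unfolding discrete_fourier_def torus_char_uminus[symmetric] by (simp add: torus_char_def)
  then have lim: "?lim = (\<lambda>\<xi>. \<Sum>\<^sub>\<infinity>l. ?h l \<xi>)"
    by (simp add: infsum_cmult_right')
  have unif: "uniform_limit (cbox 0 1) (\<lambda>F \<xi>. \<Sum>l\<in>F. ?h l \<xi>) ?lim (finite_subsets_at_top UNIV)"
    unfolding lim
  proof (rule Weierstrass_m_test_general)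
    fix l \<xi> assume "\<xi> \<in> cbox 0 (1 :: real ^ 'n)"
    then show "norm (?h l \<xi>) \<le> B * norm (f l)"
      using B by (simp add: norm_mult norm_torus_char mult_right_mono)
  next
    show "(\<lambda>l. B * norm (f l)) summable_on UNIV" by (intro summable_on_cmult_right abs_f)
  qed
  obtain I J where I: "\<And>F. ((\<lambda>\<xi>. \<Sum>l\<in>F. ?h l \<xi>) has_integral I F) (cbox 0 1)"
    and J: "(?lim has_integral J) (cbox 0 1)" and IJ: "(I \<longlongrightarrow> J) (finite_subsets_at_top UNIV)"
    by (rule uniform_limit_integral_cbox[OF unif continuous_on_sum[OF cont_h] finite_subsets_at_top_neq_bot])
      (rule that)
  have I_eq: "I F = (\<Sum>l\<in>F. fourier_coeff (m k) (k - l) * f l)" for F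
  proof -
    have "fourier_coeff (\<lambda>\<xi>. m k \<xi> * trig_poly f F \<xi>) k = integral (cbox 0 1) (\<lambda>\<xi>. \<Sum>l\<in>F. ?h l \<xi>)"
      unfolding fourier_coeff_def trig_poly_def by (simp add: sum_distrib_left mult_ac)
    also have "\<dots> = I F" using I by (rule integral_unique)
    finally show ?thesis using fourier_coeff_times_trig_poly[OF cont_m, where g = f and F = F and k = k] by simp
  qed
  have "((\<lambda>l. fourier_coeff (m k) (k - l) * f l) has_sum J) UNIV"
    using IJ unfolding has_sum_def I_eq[abs_def] .
  then have sum_J: "(\<Sum>\<^sub>\<infinity>l. fourier_coeff (m k) (k - l) * f l) = J" by (rule infsumI)
  have "continuous_on (cbox 0 1) ?lim"
    by (rule uniform_limit_theorem[OF _ unif]) (auto intro!: always_eventually continuous_on_sum cont_h)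
  then have "set_integrable lborel (cbox 0 1) ?lim"
    unfolding set_integrable_def by (intro borel_integrable_compact compact_cbox)
  then have "(LINT \<xi>:cbox 0 1|lborel. ?lim \<xi>) = integral (cbox 0 1) ?lim"
    by (rule set_borel_integral_eq_integral(2))
  also have "\<dots> = J" using J by (rule integral_unique)
  finally show ?thesis
    unfolding sum_J by (simp add: pseudo_diff_op_def torus_char_def)
qed

theorem theorem2:
  fixes m :: "int ^ 'n::finite \<Rightarrow> real ^ 'n \<Rightarrow> complex" and \<rho> :: real
  assumes "0 \<le> \<rho>" and "\<rho> < 1"
    and "\<And>k. smooth_torus (m k)"
    and "\<And>\<alpha> \<beta> :: nat ^ 'n. \<exists>C. \<forall>k \<xi>.
      cmod (mi_power partial_deriv \<beta> (\<lambda>\<eta>. mi_power partial_diff \<alpha> (\<lambda>l. m l \<eta>) k) \<xi>)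
        \<le> C * (1 + norm (lattice_vec k)) powr ((real (mi_order \<beta>) - real (mi_order \<alpha>)) * \<rho>)"
  shows "\<exists>T. bounded_op_l2 T \<and> (\<forall>f\<in>schwartz_lattice. T f = pseudo_diff_op m f)"
proof -
  define T where "T f k = (\<Sum>\<^sub>\<infinity>l. fourier_coeff (m k) (k - l) * f l)" for f k
  note summable = kernel_times_l2_summable[OF assms(3)]
  obtain B where B: "0 \<le> B" and finite_bound: "\<And>K F f. finite K \<Longrightarrow> finite F \<Longrightarrow>
      (\<Sum>k\<in>K. (cmod (\<Sum>l\<in>F. fourier_coeff (m k) (k - l) * f l))\<^sup>2) \<le> B * (\<Sum>l\<in>F. (cmod (f l))\<^sup>2)"
    using finite_section_bound[OF assms] by blast
  have partial: "(\<Sum>k\<in>K. (cmod (T f k))\<^sup>2) \<le> B * (\<Sum>\<^sub>\<infinity>l. (cmod (f l))\<^sup>2)"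
    if f: "f \<in> l2_lattice" and K: "finite K" for f K
  proof (rule tendsto_upperbound)
    show "((\<lambda>F. \<Sum>k\<in>K. (cmod (\<Sum>l\<in>F. fourier_coeff (m k) (k - l) * f l))\<^sup>2)
        \<longlongrightarrow> (\<Sum>k\<in>K. (cmod (T f k))\<^sup>2)) (finite_subsets_at_top UNIV)"
      unfolding T_def
      by (intro tendsto_intros infsum_tendsto summable f)
    have "(\<Sum>k\<in>K. (cmod (\<Sum>l\<in>F. fourier_coeff (m k) (k - l) * f l))\<^sup>2) \<le> B * (\<Sum>\<^sub>\<infinity>l. (cmod (f l))\<^sup>2)"
      if F: "finite F" for F
    proof -
      have "(\<Sum>l\<in>F. (cmod (f l))\<^sup>2) \<le> (\<Sum>\<^sub>\<infinity>l. (cmod (f l))\<^sup>2)"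
        using f F by (intro finite_sum_le_infsum) (auto simp: l2_lattice_def)
      then show ?thesis using finite_bound[OF K F, of f] B by (meson mult_left_mono order_trans)
    qed
    then show "\<forall>\<^sub>F F in finite_subsets_at_top UNIV.
        (\<Sum>k\<in>K. (cmod (\<Sum>l\<in>F. fourier_coeff (m k) (k - l) * f l))\<^sup>2) \<le> B * (\<Sum>\<^sub>\<infinity>l. (cmod (f l))\<^sup>2)"
      by (intro eventually_finite_subsets_at_top_weakI) simp
  qed simp
  have in_l2: "T f \<in> l2_lattice" if "f \<in> l2_lattice" for f
    unfolding l2_lattice_def mem_Collect_eq
  proof (rule nonneg_bdd_above_summable_on)
    show "bdd_above (sum (\<lambda>k. (cmod (T f k))\<^sup>2) ` {K. K \<subseteq> UNIV \<and> finite K})"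
      by (rule bdd_aboveI2) (use partial[OF that] in auto)
  qed simp
  have bound: "l2_norm (T f) \<le> sqrt B * l2_norm f" if f: "f \<in> l2_lattice" for f
  proof -
    have "(\<Sum>\<^sub>\<infinity>k. (cmod (T f k))\<^sup>2) \<le> B * (\<Sum>\<^sub>\<infinity>l. (cmod (f l))\<^sup>2)"
      using in_l2[OF f] partial[OF f] by (intro infsum_le_finite_sums) (auto simp: l2_lattice_def)
    then show ?thesis unfolding l2_norm_def real_sqrt_mult[symmetric] by simp
  qed
  have "bounded_op_l2 T"
    unfolding bounded_op_l2_def
  proof (intro conjI ballI allI)
    show "T ` l2_lattice \<subseteq> l2_lattice" using in_l2 by blast
    show "T (\<lambda>k. f k + g k) = (\<lambda>k. T f k + T g k)" if "f \<in> l2_lattice" "g \<in> l2_lattice" for f g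
      unfolding T_def distrib_left by (intro ext infsum_add summable that)
    show "T (\<lambda>k. c * f k) = (\<lambda>k. c * T f k)" for c f
      unfolding T_def by (simp add: infsum_cmult_right'[symmetric] mult_ac)
    show "\<exists>C. \<forall>f\<in>l2_lattice. l2_norm (T f) \<le> C * l2_norm f" using bound by blast
  qed
  moreover have "T f = pseudo_diff_op m f" if "f \<in> schwartz_lattice" for f
    using pseudo_diff_op_eq_kernel_sum[of m _ f, OF assms(3) that] by (simp add: T_def fun_eq_iff)
  ultimately show ?thesis by blast
qed

end
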